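(* Consider the condition $$(\ast)\qquad \alpha>0\ \text{ and }\ \int^{+\infty}r\ln r\,\pi(\mathrm{d}r)<+\infty .$$ Let $(Z^{\uparrow}_t)_{t\ge0}$ be the $Q$-process (the CB process with branching mechanism $\psi$ conditioned on non-extinction), started from any $x>0$. If $(\ast)$ holds, then $Z^{\uparrow}_t$ converges in distribution as $t\to+\infty$ to a positive random variable $Z^{\uparrow}_\infty$ which is equal in distribution to $V_\infty$. Otherwise, if $(\ast)$ fails, $Z^{\uparrow}_t$ converges in probability as $t\to+\infty$ to infinity.
   Context: Branching mechanism: $\psi(\lambda)=\alpha\lambda+\frac12\sigma^2\lambda^2+\int_0^{+\infty}(e^{-\lambda r}-1+\lambda r)\,\pi(\mathrm{d}r)$, $\lambda\ge 0$, where $\alpha\ge 0$, $\sigma\ge 0$ and $\pi$ is a positive Radon measure on $(0,+\infty)$ with $\int_0^{+\infty}(r\wedge r^2)\,\pi(\mathrm{d}r)<+\infty$. It is assumed that $\psi(+\infty)=+\infty$ and $\int^{+\infty}\frac{1}{\psi(\lambda)}\,\mathrm{d}\lambda<+\infty$. The notation $\int^{+\infty}$ means integrability at $+\infty$ (integral over $[c,+\infty)$ for some $c>1$). CB process: $((Z_t)_{t\ge 0},(\mathbb{P}_x)_{x\ge 0})$ is the $[0,+\infty)$-valued right continuous strong Markov process with left limits, absorbed at $0$, with $\mathbb{P}_x(Z_0=x)=1$, and such that $\mathbb{P}_x[e^{-\lambda Z_t}]=e^{-x u_t(\lambda)}$ for $\lambda>0$, $t\ge 0$, where $\frac{\partial}{\partial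 t}u_t(\lambda)=-\psi(u_t(\lambda))$, $u_0(\lambda)=\lambda$; $(\mathcal{F}_t)_{t\ge 0}$ is its filtration. $\mathbb{P}_x[\cdot]$ also denotes expectation. $Q$-process: for $x>0$, $M_t:=Z_te^{\alpha t}$ is a nonnegative $(\mathcal{F}_t)$-martingale under $\mathbb{P}_x$, and $\mathbb{P}^{\uparrow}_x$ is the probability defined by $\left.\frac{\mathrm{d}\mathbb{P}^{\uparrow}_x}{\mathrm{d}\mathbb{P}_x}\right|_{\mathcal{F}_t}=\frac{M_t}{M_0}$ for all $t\ge0$. $Z^{\uparrow}$ denotes the process $Z$ under $\mathbb{P}^{\uparrow}_x$. $V_\infty$: let $\phi(\lambda):=\int_\lambda^{+\infty}\frac{1}{\psi(u)}\,\mathrm{d}u$ for $\lambda>0$, a strictly decreasing bijection of $(0,+\infty)$, with inverse $\varphi$. For $q>0$, $V_q$ is the positive random variable whose law is determined by $\mathrm{E}[e^{-\lambda V_q}]=e^{-\alpha(\phi(\lambda+\varphi(q))-q)}\frac{\psi(\varphi(q))}{\psi(\lambda+\varphi(q))}$, $\lambda>0$. When $(\ast)$ holds, $V_\infty$ is the positive random variable that is the limit in distribution of $V_q$ as $q\to+\infty$; its law satisfies $-\ln\mathrm{E}[e^{-\lambda V_\infty}]=\int_0^\lambda\frac{\psi'(s)-\alpha}{\psi(s)}\,\mathrm{d}s$, $\lambda>0$. Convergence in probability to infinity means $\mathbb{P}^{\uparrow}_x(Z^{\uparrow}_t>M)\to1$ for every $M>0$. *)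

theory Defs
  imports "HOL-Probability.Probability"
begin

section \<open>Branching mechanism\<close>

text \<open>The Levy measure is a measure on the space \<open>(0, \<infinity>)\<close>, so that integrals with respect to it
  are over \<open>(0, \<infinity>)\<close>.\<close>

definition psi :: "real \<Rightarrow> real \<Rightarrow> real measure \<Rightarrow> real \<Rightarrow> real" where
  "psi \<alpha> \<sigma> \<pi> l =
     \<alpha> * l + 1/2 * \<sigma>\<^sup>2 * l\<^sup>2 + (\<integral>r. (exp (- l * r) - 1 + l * r) \<partial>\<pi>)"

locale branching_mechanism =
  fixes \<alpha> \<sigma> :: real and \<pi> :: "real measure"
  assumes alpha_nonneg: "0 \<le> \<alpha>"
    and sigma_nonneg: "0 \<le> \<sigma>"
    and sets_pi: "sets \<pi> = sets (restrict_space borel {0<..})"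
    and radon_pi: "\<And>K. compact K \<Longrightarrow> K \<subseteq> {0<..} \<Longrightarrow> emeasure \<pi> K < \<infinity>"
    and integrable_pi: "integrable \<pi> (\<lambda>r. min r (r\<^sup>2))"
    and psi_at_top: "filterlim (psi \<alpha> \<sigma> \<pi>) at_top at_top"
    and inverse_psi_integrable: "\<exists>c>1. set_integrable lborel {c..} (\<lambda>l. 1 / psi \<alpha> \<sigma> \<pi> l)"

text \<open>The condition \<open>(\<ast>)\<close>.\<close>

definition log_moment_condition :: "real \<Rightarrow> real measure \<Rightarrow> bool" where
  "log_moment_condition \<alpha> \<pi> \<longleftrightarrow>
     0 < \<alpha> \<and> (\<exists>c>1. set_integrable \<pi> {c..} (\<lambda>r. r * ln r))"

section \<open>Continuous-state branching processes\<close>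

text \<open>Requiring \<open>u \<ge> 0\<close> keeps the solution in the domain \<open>[0, \<infinity>)\<close> of the branching mechanism.\<close>

definition cumulant_flow :: "real \<Rightarrow> real \<Rightarrow> real measure \<Rightarrow> (real \<Rightarrow> real \<Rightarrow> real) \<Rightarrow> bool" where
  "cumulant_flow \<alpha> \<sigma> \<pi> u \<longleftrightarrow>
     (\<forall>l>0. u 0 l = l \<and>
        (\<forall>t\<ge>0. 0 \<le> u t l \<and>
           ((\<lambda>s. u s l) has_real_derivative - psi \<alpha> \<sigma> \<pi> (u t l)) (at t within {0..})))"

text \<open>Time is indexed by \<open>[0, \<infinity>]\<close>, so that the library notions of stopping time and of the
  \<open>\<sigma>\<close>-algebra of a stopping time allow the value \<open>\<infinity>\<close>; at time \<open>\<infinity>\<close> the filtration is the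
  \<open>\<sigma>\<close>-algebra generated by the whole process.\<close>

definition natural_filtration ::
    "'w measure \<Rightarrow> (real \<Rightarrow> 'w \<Rightarrow> real) \<Rightarrow> ennreal \<Rightarrow> 'w measure" where
  "natural_filtration M Z t =
     sigma (space M) {Z s -` A \<inter> space M |s A. 0 \<le> s \<and> ennreal s \<le> t \<and> A \<in> sets borel}"

lemma filtration_natural_filtration: "filtration (space M) (natural_filtration M Z)"
proof
  show "space (natural_filtration M Z i) = space M" for i
    by (auto simp: natural_filtration_def intro!: space_measure_of)
  show "sets (natural_filtration M Z i) \<le> sets (natural_filtration M Z j)" if "i \<le> j" for i j
  proof -
    have "{Z s -` A \<inter> space M |s A. 0 \<le> s \<and> ennreal s \<le> i \<and> A \<in> sets borel}
        \<subseteq> {Z s -` A \<inter> space M |s A. 0 \<le> s \<and> ennreal s \<le> j \<and> A \<in> sets borel}"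
      using that by (blast intro: order_trans)
    then show ?thesis
      unfolding natural_filtration_def
      by (subst (1 2) sets_measure_of) (auto intro!: sigma_sets_mono')
  qed
qed

text \<open>The strong Markov property with respect to the natural filtration: on \<open>{T < \<infinity>}\<close>,
  \<open>P\<^sub>x[f(Z\<^sub>T\<^sub>+\<^sub>t) | F\<^sub>T] = P\<^sub>y[f(Z\<^sub>t)]\<close> at \<open>y = Z\<^sub>T\<close>.\<close>

definition strong_Markov ::
    "'w measure \<Rightarrow> (real \<Rightarrow> 'w \<Rightarrow> real) \<Rightarrow> (real \<Rightarrow> 'w measure) \<Rightarrow> bool" where
  "strong_Markov M Z P \<longleftrightarrow>
     (\<forall>x\<ge>0. \<forall>T. stopping_time (natural_filtration M Z) T \<longrightarrow>
        (\<forall>t\<ge>0. \<forall>f :: real \<Rightarrow> real. f \<in> borel_measurable borel \<longrightarrow> bounded (range f) \<longrightarrow>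
           (AE \<omega> in P x. T \<omega> < \<infinity> \<longrightarrow>
              real_cond_exp (P x)
                (filtration.pre_sigma (space M) (natural_filtration M Z) T)
                (\<lambda>\<omega>'. if T \<omega>' < \<infinity> then f (Z (enn2real (T \<omega>') + t) \<omega>') else 0) \<omega>
              = (\<integral>\<omega>'. f (Z t \<omega>') \<partial>P (Z (enn2real (T \<omega>)) \<omega>)))))"

text \<open>\<open>P x\<close> is only meaningful for \<open>x \<ge> 0\<close>, and \<open>Z t\<close> only for \<open>t \<ge> 0\<close>.\<close>

locale CB_process = branching_mechanism \<alpha> \<sigma> \<pi>
  for \<alpha> \<sigma> :: real and \<pi> :: "real measure" +
  fixes M :: "'w measure" and Z :: "real \<Rightarrow> 'w \<Rightarrow> real"
    and P :: "real \<Rightarrow> 'w measure" and u :: "real \<Rightarrow> real \<Rightarrow> real"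
  assumes prob_space_P: "\<And>x. 0 \<le> x \<Longrightarrow> prob_space (P x)"
    and sets_P: "\<And>x. 0 \<le> x \<Longrightarrow> sets (P x) = sets M"
    and measurable_Z: "\<And>t. 0 \<le> t \<Longrightarrow> Z t \<in> borel_measurable M"
    and nonneg_Z: "\<And>t \<omega>. 0 \<le> t \<Longrightarrow> \<omega> \<in> space M \<Longrightarrow> 0 \<le> Z t \<omega>"
    and right_continuous_Z:
      "\<And>t \<omega>. 0 \<le> t \<Longrightarrow> \<omega> \<in> space M \<Longrightarrow> continuous (at_right t) (\<lambda>s. Z s \<omega>)"
    and left_limits_Z:
      "\<And>t \<omega>. 0 < t \<Longrightarrow> \<omega> \<in> space M \<Longrightarrow> \<exists>l. ((\<lambda>s. Z s \<omega>) \<longlongrightarrow> l) (at_left t)"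
    and absorbed_Z:
      "\<And>x. 0 \<le> x \<Longrightarrow> AE \<omega> in P x. \<forall>s t. 0 \<le> s \<longrightarrow> s \<le> t \<longrightarrow> Z s \<omega> = 0 \<longrightarrow> Z t \<omega> = 0"
    and start_Z: "\<And>x. 0 \<le> x \<Longrightarrow> AE \<omega> in P x. Z 0 \<omega> = x"
    and strong_Markov_Z: "strong_Markov M Z P"
    and cumulant_flow_u: "cumulant_flow \<alpha> \<sigma> \<pi> u"
    and laplace_Z:
      "\<And>x t l. 0 \<le> x \<Longrightarrow> 0 \<le> t \<Longrightarrow> 0 < l \<Longrightarrow>
         (\<integral>\<omega>. exp (- l * Z t \<omega>) \<partial>P x) = exp (- x * u t l)"

section \<open>The Q-process\<close>

definition Q_martingale :: "real \<Rightarrow> (real \<Rightarrow> 'w \<Rightarrow> real) \<Rightarrow> real \<Rightarrow> 'w \<Rightarrow> real" where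
  "Q_martingale \<alpha> Z t \<omega> = Z t \<omega> * exp (\<alpha> * t)"

definition is_Q_measure ::
    "real \<Rightarrow> 'w measure \<Rightarrow> (real \<Rightarrow> 'w \<Rightarrow> real) \<Rightarrow> 'w measure \<Rightarrow> 'w measure \<Rightarrow> bool" where
  "is_Q_measure \<alpha> M Z Px Q \<longleftrightarrow>
     prob_space Q \<and> sets Q = sets M \<and>
     (\<forall>t\<ge>0. restr_to_subalg Q (natural_filtration M Z (ennreal t)) =
        density (restr_to_subalg Px (natural_filtration M Z (ennreal t)))
          (\<lambda>\<omega>. ennreal (Q_martingale \<alpha> Z t \<omega> / Q_martingale \<alpha> Z 0 \<omega>)))"

section \<open>The variables \<open>V\<^sub>q\<close> and \<open>V\<^sub>\<infinity>\<close>\<close>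

text \<open>Random variables that matter only through their distribution are represented by their
  laws on the real line.\<close>

definition phi :: "real \<Rightarrow> real \<Rightarrow> real measure \<Rightarrow> real \<Rightarrow> real" where
  "phi \<alpha> \<sigma> \<pi> l = (LBINT v:{l..}. 1 / psi \<alpha> \<sigma> \<pi> v)"

definition phi_inv :: "real \<Rightarrow> real \<Rightarrow> real measure \<Rightarrow> real \<Rightarrow> real" where
  "phi_inv \<alpha> \<sigma> \<pi> = the_inv_into {0<..} (phi \<alpha> \<sigma> \<pi>)"

definition positive_law :: "real measure \<Rightarrow> bool" where
  "positive_law \<mu> \<longleftrightarrow> real_distribution \<mu> \<and> measure \<mu> {0<..} = 1"

definition is_V_law :: "real \<Rightarrow> real \<Rightarrow> real measure \<Rightarrow> real \<Rightarrow> real measure \<Rightarrow> bool" where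
  "is_V_law \<alpha> \<sigma> \<pi> q \<mu> \<longleftrightarrow> positive_law \<mu> \<and>
     (\<forall>l>0. (\<integral>v. exp (- l * v) \<partial>\<mu>) =
        exp (- \<alpha> * (phi \<alpha> \<sigma> \<pi> (l + phi_inv \<alpha> \<sigma> \<pi> q) - q)) *
        (psi \<alpha> \<sigma> \<pi> (phi_inv \<alpha> \<sigma> \<pi> q) / psi \<alpha> \<sigma> \<pi> (l + phi_inv \<alpha> \<sigma> \<pi> q)))"

text \<open>The library's \<^const>\<open>weak_conv_m\<close> treats sequences only; here the index runs along an
  arbitrary filter.\<close>

definition weak_conv_along :: "('i \<Rightarrow> real measure) \<Rightarrow> real measure \<Rightarrow> 'i filter \<Rightarrow> bool" where
  "weak_conv_along \<mu>s \<mu> F \<longleftrightarrow>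
     (\<forall>x. isCont (cdf \<mu>) x \<longrightarrow> ((\<lambda>i. cdf (\<mu>s i) x) \<longlongrightarrow> cdf \<mu> x) F)"

lemma weak_conv_along_sequentially: "weak_conv_along \<mu>s \<mu> sequentially \<longleftrightarrow> weak_conv_m \<mu>s \<mu>"
  by (simp add: weak_conv_along_def weak_conv_m_def weak_conv_def)

definition is_V_infinity_law :: "(real \<Rightarrow> real measure) \<Rightarrow> real measure \<Rightarrow> bool" where
  "is_V_infinity_law V \<mu> \<longleftrightarrow> positive_law \<mu> \<and> weak_conv_along V \<mu> at_top"

end

theory Submission
  imports Defs
begin

text \<open>
  Everything is expressed through the function \<open>H(a) = \<psi>(a) exp(\<alpha> \<phi>(a))\<close> on \<open>(0, \<infinity>)\<close>,
  called \<open>tilted_psi\<close> below. Since \<open>\<phi>' = - 1 / \<psi>\<close>, the flow satisfies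
  \<open>\<phi>(u\<^sub>t(\<lambda>)) = \<phi>(\<lambda>) + t\<close>, hence \<open>\<partial>u\<^sub>t(\<lambda>)/\<partial>\<lambda> = \<psi>(u\<^sub>t(\<lambda>)) / \<psi>(\<lambda>)\<close>. Differentiating the
  Laplace transform of \<open>Z\<^sub>t\<close> in \<open>\<lambda>\<close> brings down the factor \<open>Z\<^sub>t\<close> of the martingale density, so
  under the Q-measure
  \<open>E[exp(- \<lambda> Z\<^sub>t)] = e\<^sup>\<alpha>\<^sup>t (\<psi>(u\<^sub>t(\<lambda>)) / \<psi>(\<lambda>)) exp(- x u\<^sub>t(\<lambda>)) = (H(u\<^sub>t(\<lambda>)) / H(\<lambda>)) exp(- x u\<^sub>t(\<lambda>))\<close>
  (lemma \<open>laplace_Z_Q\<close>). In the same way the Laplace transform of \<open>V\<^sub>q\<close> is \<open>H(a) / H(\<lambda> + a)\<close>, where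
  \<open>\<phi>(a) = q\<close>. Both \<open>u\<^sub>t(\<lambda>)\<close> as \<open>t \<rightarrow> \<infinity>\<close> and \<open>a\<close> as \<open>q \<rightarrow> \<infinity>\<close> decrease to \<open>0\<close>, so both transforms
  converge to \<open>h / H(\<lambda>)\<close> with \<open>h = H(0+)\<close>.

  The heart of the matter is that \<open>h\<close> exists and that \<open>h > 0\<close> holds exactly under the logarithmic
  moment condition (lemma \<open>tilted_psi_tendsto_at_right_0\<close>). Write
  \<open>H(a) = (\<psi>(a) / a) exp(K(a))\<close> with \<open>K(a) = ln a + \<alpha> \<phi>(a)\<close>. The first factor tends to \<open>\<alpha>\<close>. The
  function \<open>K\<close> is nondecreasing, because \<open>K'(a) = (\<psi>(a) - \<alpha> a) / (a \<psi>(a))\<close>. If \<open>\<alpha> > 0\<close>, then \<open>\<psi>(a)\<close>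
  is comparable to \<open>a\<close> near \<open>0\<close>, so \<open>K\<close> is bounded below at \<open>0\<close> if and only if
  \<open>(\<psi>(s) - \<alpha> s) / s\<^sup>2\<close> is integrable over \<open>(0, 1]\<close>. By Tonelli this integral equals
  \<open>\<sigma>\<^sup>2 / 2 + \<integral> g(r) \<pi>(dr)\<close>, where \<open>g(r) = \<integral>\<^bsub>(0,1]\<^esub> (exp(- s r) - 1 + s r) / s\<^sup>2 ds\<close> is of order
  \<open>r\<^sup>2\<close> at \<open>0\<close> and of order \<open>r ln r\<close> at \<open>\<infinity>\<close>. This route avoids the derivative of \<open>\<psi>\<close> altogether.

  If \<open>h > 0\<close>, the limit \<open>h / H(\<lambda>)\<close> tends to \<open>1\<close> as \<open>\<lambda> \<rightarrow> 0\<close>, and the continuity theorem for Laplace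
  transforms gives a common weak limit of the two families; it has no atom at \<open>0\<close> because
  \<open>H(\<lambda>) \<ge> \<psi>(\<lambda>) \<rightarrow> \<infinity>\<close>. If \<open>h = 0\<close>, the transform of \<open>Z\<^sub>t\<close> vanishes in the limit, and Markov's
  inequality for \<open>exp(- Z\<^sub>t)\<close> shows that \<open>Z\<^sub>t\<close> tends to \<open>\<infinity>\<close> in probability.

  The continuity theorem itself rests on two facts: functions of \<open>exp(- v)\<close> are uniformly
  approximated by polynomials in \<open>exp(- v)\<close>, so the values of the transforms at the integers control
  weak convergence (lemma \<open>Laplace_conv_imp_weak_conv\<close>); and a limit of transforms that tends to \<open>1\<close>
  at the origin forces tightness, so that Helly selection provides a limit law (lemma
  \<open>Laplace_limit_is_Laplace_transform\<close>).
\<close>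

section \<open>Laplace transforms and weak convergence on the half-line\<close>

definition laplace :: "real measure \<Rightarrow> real \<Rightarrow> real" where
  "laplace \<mu> l = (\<integral>v. exp (- l * v) \<partial>\<mu>)"

lemma integrable_exp_neg_mult:
  assumes "real_distribution \<mu>" and "AE v in \<mu>. 0 \<le> v" and "0 \<le> l"
  shows "integrable \<mu> (\<lambda>v. exp (- l * v))"
proof -
  interpret real_distribution \<mu> by fact
  show ?thesis
    by (rule integrable_const_bound[of _ 1]) (use assms(2,3) in \<open>auto elim!: eventually_mono\<close>)
qed

text \<open>Weak convergence can be tested on the piecewise linear functions \<open>cts_step\<close>. In the
variable \<open>w = exp(- v)\<close> such a function extends continuously to \<open>[0, 1]\<close>, as it vanishes for large
\<open>v\<close>, and the Weierstrass theorem applies.\<close>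

lemma polynomial_approx_cts_step:
  fixes x y e :: real
  assumes xy: "x < y" and e: "0 < e"
  obtains a :: "nat \<Rightarrow> real" and d :: nat
  where "\<And>v. 0 \<le> v \<Longrightarrow> \<bar>cts_step x y v - (\<Sum>i\<le>d. a i * exp (- real i * v))\<bar> \<le> e"
proof -
  \<comment> \<open>Truncating at \<open>exp(- y)\<close> keeps the logarithm away from \<open>0\<close> and changes nothing,
    as \<open>cts_step x y\<close> vanishes beyond \<open>y\<close>.\<close>
  define g where "g w = cts_step x y (- ln (max w (exp (- y))))" for w
  have cts: "continuous_on UNIV (cts_step x y)"
    by (intro uniformly_continuous_imp_continuous cts_step_uniformly_continuous xy)
  have mpos: "0 < max w (exp (- y))" for w :: real
    using exp_gt_zero[of "-y"] by linarith
  have "continuous_on {0..1} (\<lambda>w. - ln (max w (exp (- y))))"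
    using mpos by (intro continuous_intros ballI) (metis less_irrefl)
  then have "continuous_on {0..1} g"
    unfolding g_def by (rule continuous_on_compose2[OF cts]) auto
  then obtain p where p: "real_polynomial_function p" "\<And>w. w \<in> {0..1} \<Longrightarrow> \<bar>g w - p w\<bar> < e"
    using Stone_Weierstrass_real_polynomial_function[OF compact_Icc _ e] by metis
  obtain a d where pa: "p = (\<lambda>w. \<Sum>i\<le>d. a i * w ^ i)"
    using p(1) unfolding real_polynomial_function_iff_sum by blast
  have "\<bar>cts_step x y v - (\<Sum>i\<le>d. a i * exp (- real i * v))\<bar> \<le> e" if "0 \<le> v" for v
  proof -
    have "g (exp (- v)) = cts_step x y v"
    proof (cases "v \<le> y")
      case True
      then show ?thesis by (simp add: g_def max_absorb1)
    next
      case False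
      then show ?thesis using xy by (simp add: g_def max_absorb2 cts_step_def)
    qed
    moreover have "p (exp (- v)) = (\<Sum>i\<le>d. a i * exp (- real i * v))"
      by (simp add: pa exp_of_nat_mult[symmetric])
    ultimately show ?thesis using p(2)[of "exp (- v)"] that by simp
  qed
  then show thesis by (rule that[of a d])
qed

text \<open>Only transforms at positive integers enter, since these integrate polynomials in \<open>exp(- v)\<close>; the
constant term is taken care of by the total mass.\<close>

lemma Laplace_conv_imp_weak_conv:
  fixes \<mu> :: "nat \<Rightarrow> real measure"
  assumes \<mu>: "\<And>n. real_distribution (\<mu> n)" and \<nu>: "real_distribution \<nu>"
    and \<mu>_nonneg: "\<And>n. AE v in \<mu> n. 0 \<le> v" and \<nu>_nonneg: "AE v in \<nu>. 0 \<le> v"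
    and conv: "\<And>k::nat. 0 < k \<Longrightarrow>
      (\<lambda>n. laplace (\<mu> n) (real k)) \<longlonglongrightarrow> laplace \<nu> (real k)"
  shows "weak_conv_m \<mu> \<nu>"
proof (rule integral_cts_step_conv_imp_weak_conv[OF \<mu> \<nu>])
  fix x y :: real assume xy: "x < y"
  show "(\<lambda>n. integral\<^sup>L (\<mu> n) (cts_step x y)) \<longlonglongrightarrow> integral\<^sup>L \<nu> (cts_step x y)"
  proof (rule tendstoI)
    fix e :: real assume "0 < e"
    then obtain a d where ad:
      "\<And>v. 0 \<le> v \<Longrightarrow> \<bar>cts_step x y v - (\<Sum>i\<le>d. a i * exp (- real i * v))\<bar> \<le> e / 3"
      using polynomial_approx_cts_step[OF xy, of "e / 3"] by (metis divide_pos_pos zero_less_numeral)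
    define I where "I \<rho> = (\<Sum>i\<le>d. a i * laplace \<rho> (real i))" for \<rho> :: "real measure"
    have approx: "\<bar>integral\<^sup>L \<rho> (cts_step x y) - I \<rho>\<bar> \<le> e / 3"
      if \<rho>: "real_distribution \<rho>" "AE v in \<rho>. 0 \<le> v" for \<rho>
    proof -
      interpret real_distribution \<rho> by fact
      let ?p = "\<lambda>v. \<Sum>i\<le>d. a i * exp (- real i * v)"
      have exps: "integrable \<rho> (\<lambda>v. a i * exp (- real i * v))" for i
        by (rule integrable_mult_right) (simp only: integrable_exp_neg_mult[OF \<rho>] of_nat_0_le_iff)
      have int: "integrable \<rho> ?p" by (rule Bochner_Integration.integrable_sum) (rule exps)
      note intc = integrable_cts_step[OF xy]
      have "integral\<^sup>L \<rho> ?p = I \<rho>"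
        unfolding I_def laplace_def
        by (subst Bochner_Integration.integral_sum[OF exps]) (rule sum.cong[OF refl integral_mult_right_zero])
      then have eq: "integral\<^sup>L \<rho> (cts_step x y) - I \<rho> = (\<integral>v. cts_step x y v - ?p v \<partial>\<rho>)"
        by (simp only: Bochner_Integration.integral_diff[OF intc int])
      have bounds: "cts_step x y v - ?p v \<le> e / 3" "- (e / 3) \<le> cts_step x y v - ?p v" if "0 \<le> v" for v
        using ad[OF that] by linarith+
      have "(\<integral>v. cts_step x y v - ?p v \<partial>\<rho>) \<le> e / 3"
        by (rule integral_le_const[OF Bochner_Integration.integrable_diff[OF intc int]])
          (rule eventually_mono[OF \<rho>(2) bounds(1)])
      moreover have "- (e / 3) \<le> (\<integral>v. cts_step x y v - ?p v \<partial>\<rho>)"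
        by (rule integral_ge_const[OF Bochner_Integration.integrable_diff[OF intc int]])
          (rule eventually_mono[OF \<rho>(2) bounds(2)])
      ultimately show ?thesis unfolding eq by linarith
    qed
    have "(\<lambda>n. I (\<mu> n)) \<longlonglongrightarrow> I \<nu>"
      unfolding I_def
    proof (intro tendsto_sum tendsto_mult tendsto_const)
      fix i
      show "(\<lambda>n. laplace (\<mu> n) (real i)) \<longlonglongrightarrow> laplace \<nu> (real i)"
      proof (cases "i = 0")
        case True
        interpret \<mu>: real_distribution "\<mu> n" for n by (rule \<mu>)
        interpret \<nu>: real_distribution \<nu> by (rule \<nu>)
        show ?thesis using \<mu>.prob_space \<nu>.prob_space by (simp add: True laplace_def)
      qed (use conv in blast)
    qed
    then have "\<forall>\<^sub>F n in sequentially. dist (I (\<mu> n)) (I \<nu>) < e / 3"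
      using \<open>0 < e\<close> by (intro tendstoD) auto
    then show "\<forall>\<^sub>F n in sequentially.
        dist (integral\<^sup>L (\<mu> n) (cts_step x y)) (integral\<^sup>L \<nu> (cts_step x y)) < e"
    proof eventually_elim
      case (elim n)
      show ?case using elim approx[OF \<mu> \<mu>_nonneg, of n] approx[OF \<nu> \<nu>_nonneg]
        unfolding dist_real_def by linarith
    qed
  qed
qed

text \<open>For \<open>v > 1 / l\<close> one has \<open>1 - exp(- l v) \<ge> 1 - exp(-1) \<ge> 1 / 2\<close>, and the inequality is Markov's.\<close>

lemma Laplace_tail_bound:
  assumes \<mu>: "real_distribution \<mu>" and nonneg: "AE v in \<mu>. 0 \<le> v" and l: "0 < l"
  shows "measure \<mu> {1 / l<..} \<le> 2 * (1 - laplace \<mu> l)"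
proof -
  interpret real_distribution \<mu> by fact
  have int: "integrable \<mu> (\<lambda>v. exp (- l * v))"
    using l by (intro integrable_exp_neg_mult[OF \<mu> nonneg]) simp
  have half: "exp (-1) \<le> (1 / 2 :: real)"
    using exp_ge_add_one_self[of 1] by (simp add: exp_minus field_simps)
  have "measure \<mu> {1 / l<..} = (\<integral>v. indicator {1 / l<..} v \<partial>\<mu>)"
    by simp
  also have "\<dots> \<le> (\<integral>v. 2 * (1 - exp (- l * v)) \<partial>\<mu>)"
  proof (rule integral_mono_AE)
    show "AE v in \<mu>. indicator {1 / l<..} v \<le> 2 * (1 - exp (- l * v))"
      using nonneg
    proof eventually_elim
      case (elim v)
      show ?case
      proof (cases "1 / l < v")
        case True
        then have "exp (- l * v) \<le> exp (-1)" using l by (simp add: field_simps)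
        then have "exp (- l * v) \<le> 1 / 2" using half by (rule order_trans)
        then have "1 \<le> 2 * (1 - exp (- l * v))" by (simp add: field_simps)
        moreover have "indicator {1 / l<..} v \<le> (1 :: real)" by (simp add: indicator_def)
        ultimately show ?thesis by (rule order_trans[rotated])
      next
        case False
        then show ?thesis using l elim by (simp add: indicator_def)
      qed
    qed
  next
    show "integrable \<mu> (\<lambda>v. 2 * (1 - exp (- l * v)))"
      by (intro integrable_mult_right Bochner_Integration.integrable_diff int) simp
  qed (simp add: emeasure_eq_measure)
  also have "\<dots> = 2 * (1 - laplace \<mu> l)"
  proof -
    have "(\<integral>v. 1 - exp (- l * v) \<partial>\<mu>) = (\<integral>v. 1 \<partial>\<mu>) - laplace \<mu> l"
      unfolding laplace_def by (rule Bochner_Integration.integral_diff[OF _ int]) simp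
    also have "(\<integral>v. 1 \<partial>\<mu>) = (1 :: real)" using prob_space by simp
    finally show ?thesis by (simp only: integral_mult_right_zero)
  qed
  finally show ?thesis .
qed

text \<open>The tail bound at a small \<open>l\<close> controls all laws from some index on; the finitely many others are
each tight on their own, so a common bound is a maximum.\<close>

lemma Laplace_limit_imp_tight:
  fixes \<mu> :: "nat \<Rightarrow> real measure"
  assumes \<mu>: "\<And>n. real_distribution (\<mu> n)" and nonneg: "\<And>n. AE v in \<mu> n. 0 \<le> v"
    and conv: "\<And>l. 0 < l \<Longrightarrow> (\<lambda>n. laplace (\<mu> n) l) \<longlonglongrightarrow> L l"
    and L: "(L \<longlongrightarrow> 1) (at_right 0)"
  shows "tight \<mu>"
  unfolding tight_def
proof (intro conjI allI impI \<mu>)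
  fix e :: real assume e: "0 < e"
  have neg: "measure (\<mu> n) {..-1} = 0" for n
  proof -
    interpret real_distribution "\<mu> n" by (rule \<mu>)
    show ?thesis
      using nonneg[of n] by (subst prob_eq_0) (auto elim!: eventually_mono)
  qed
  have compl: "1 - measure (\<mu> n) {-1<..b} = measure (\<mu> n) {b<..}" if "0 < b" for n b
  proof -
    interpret real_distribution "\<mu> n" by (rule \<mu>)
    have "UNIV = {..-1} \<union> ({-1<..b} \<union> {b<..})" using that by auto
    then have "1 = measure (\<mu> n) ({..-1} \<union> ({-1<..b} \<union> {b<..}))" using prob_space by (metis space_eq_univ)
    also have "\<dots> = measure (\<mu> n) {..-1} + (measure (\<mu> n) {-1<..b} + measure (\<mu> n) {b<..})"
    proof -
      have "{..-1} \<inter> ({-1<..b} \<union> {b<..}) = {}" "{-1<..b} \<inter> {b<..} = {}" using that by auto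
      then show ?thesis by (simp only: finite_measure_Union events_eq_borel sets.Un greaterThanAtMost_borel greaterThan_borel atMost_borel)
    qed
    finally show ?thesis using neg by simp
  qed
  have "\<forall>\<^sub>F l in at_right 0. 1 - e / 2 < L l"
    using e by (intro order_tendstoD(1)[OF L]) simp
  then have "\<forall>\<^sub>F l in at_right 0. 0 < l \<and> 1 - e / 2 < L l"
    using eventually_at_right_less[of "0::real"] by eventually_elim simp
  then have "\<exists>l. 0 < l \<and> 1 - e / 2 < L l"
    by (rule eventually_happens'[rotated]) simp
  then obtain l where l: "0 < l" "1 - e / 2 < L l" by blast
  obtain N where N: "\<And>n. n \<ge> N \<Longrightarrow> 1 - e / 2 < laplace (\<mu> n) l"
    using order_tendstoD(1)[OF conv[OF l(1)] l(2)] by (auto simp: eventually_sequentially)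
  have large: "measure (\<mu> n) {1 / l<..} < e" if "n \<ge> N" for n
  proof -
    have "2 * (1 - laplace (\<mu> n) l) < e" using N[OF that] by (simp add: field_simps)
    then show ?thesis by (rule le_less_trans[OF Laplace_tail_bound[OF \<mu> nonneg l(1)]])
  qed
  have "\<exists>b. measure (\<mu> n) {b<..} < e" for n
  proof -
    interpret real_distribution "\<mu> n" by (rule \<mu>)
    have "\<forall>\<^sub>F b in at_top. 1 - e < cdf (\<mu> n) b"
      using cdf_lim_at_top_prob e by (intro order_tendstoD) auto
    then obtain b where "1 - e < cdf (\<mu> n) b"
      using eventually_happens[of _ "at_top :: real filter"] by auto
    moreover have "measure (\<mu> n) {b<..} = 1 - cdf (\<mu> n) b"
      using prob_compl[of "{..b}"] by (simp add: cdf_def Compl_eq_Diff_UNIV[symmetric] Compl_atMost)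
    ultimately show ?thesis by (intro exI[of _ b]) linarith
  qed
  then obtain b where b: "\<And>n. measure (\<mu> n) {b n<..} < e" by metis
  define B where "B = Max (insert (1 / l) (b ` {..N}))"
  have B: "1 / l \<le> B" "\<And>n. n \<le> N \<Longrightarrow> b n \<le> B" 
    unfolding B_def by (intro Max_ge; simp)+
  have Bpos: "0 < B" using B(1) l(1) by (meson less_le_trans zero_less_divide_1_iff)
  have "measure (\<mu> n) {B<..} < e" for n
  proof -
    interpret real_distribution "\<mu> n" by (rule \<mu>)
    have mono: "measure (\<mu> n) {B<..} \<le> measure (\<mu> n) {c<..}" if "c \<le> B" for c
      using that by (intro finite_measure_mono) auto
    show ?thesis
      using mono[OF B(1)] mono[OF B(2), of n] large[of n] b[of n] by (cases "n \<le> N") auto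
  qed
  then have "measure (\<mu> n) {-1<..B} > 1 - e" for n
    using compl[OF Bpos, of n] by (metis diff_less_eq add.commute less_diff_eq)
  then show "\<exists>a b. a < b \<and> (\<forall>n. measure (\<mu> n) {a<..b} > 1 - e)"
    using Bpos by (intro exI[of _ "-1"] exI[of _ B]) auto
qed

text \<open>Existence half of the continuity theorem. The limit law comes from Helly selection; weak
convergence also keeps the mass on the half-line and passes to the transforms.\<close>

lemma Laplace_limit_is_Laplace_transform:
  fixes \<mu> :: "nat \<Rightarrow> real measure"
  assumes \<mu>: "\<And>n. real_distribution (\<mu> n)" and nonneg: "\<And>n. AE v in \<mu> n. 0 \<le> v"
    and conv: "\<And>l. 0 < l \<Longrightarrow> (\<lambda>n. laplace (\<mu> n) l) \<longlonglongrightarrow> L l"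
    and L: "(L \<longlongrightarrow> 1) (at_right 0)"
  obtains \<nu> where "real_distribution \<nu>" "AE v in \<nu>. 0 \<le> v"
    "\<And>l. 0 < l \<Longrightarrow> laplace \<nu> l = L l"
proof -
  have "tight \<mu>" by (rule Laplace_limit_imp_tight[OF assms])
  then obtain r \<nu> where r: "strict_mono (r :: nat \<Rightarrow> nat)" and \<nu>: "real_distribution \<nu>"
    and w: "weak_conv_m (\<mu> \<circ> r) \<nu>"
    using tight_imp_convergent_subsubsequence[of \<mu> id] by (auto simp: strict_mono_def)
  have \<mu>r: "real_distribution ((\<mu> \<circ> r) n)" for n using \<mu> by simp
  interpret \<nu>: real_distribution \<nu> by fact
  \<comment> \<open>Weak convergence needs a test function bounded on the whole line.\<close>
  define h where "h l v = exp (- l * max v 0)" for l v :: real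
  have h_lim: "(\<lambda>n. integral\<^sup>L (\<mu> (r n)) (h l)) \<longlonglongrightarrow> integral\<^sup>L \<nu> (h l)" if "0 < l" for l
  proof -
    have "isCont (h l) v" for v unfolding h_def by (intro continuous_intros)
    moreover have "norm (h l v) \<le> 1" for v using that by (simp add: h_def)
    ultimately show ?thesis
      using weak_conv_imp_integral_bdd_continuous_conv[OF \<mu>r \<nu> w, of "h l" 1] by (simp add: o_def)
  qed
  have h_eq: "laplace \<rho> l = integral\<^sup>L \<rho> (h l)"
    if "real_distribution \<rho>" "AE v in \<rho>. 0 \<le> v" for l \<rho>
  proof -
    interpret \<rho>: real_distribution \<rho> by fact
    show ?thesis
      unfolding h_def laplace_def
    proof (rule integral_cong_AE)
      show "AE v in \<rho>. exp (- l * v) = exp (- l * max v 0)"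
        using that(2) by eventually_elim (simp add: max_absorb1)
    qed auto
  qed
  have h_L: "integral\<^sup>L \<nu> (h l) = L l" if "0 < l" for l
  proof (rule LIMSEQ_unique[OF h_lim[OF that]])
    show "(\<lambda>n. integral\<^sup>L (\<mu> (r n)) (h l)) \<longlonglongrightarrow> L l"
      using LIMSEQ_subseq_LIMSEQ[OF conv[OF that] r] h_eq[OF \<mu> nonneg] by (simp add: o_def)
  qed
  have cdf0: "cdf \<nu> c = 0" if "c < 0" for c
  proof -
    obtain c' where c': "c < c'" "c' < 0" "isCont (cdf \<nu>) c'"
      using open_minus_countable[OF mono_ctble_discont[of "cdf \<nu>"], of "{c<..<0}"] \<open>c < 0\<close>
      by (auto simp: mono_def \<nu>.cdf_nondecreasing)
    have "cdf (\<mu> (r n)) c' = 0" for n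
    proof -
      interpret real_distribution "\<mu> (r n)" by (rule \<mu>)
      show ?thesis
        using nonneg[of "r n"] c' by (auto simp: cdf_def prob_eq_0 elim!: eventually_mono)
    qed
    then have "cdf \<nu> c' = 0"
      using w c'(3) by (auto simp: weak_conv_m_def weak_conv_def LIMSEQ_const_iff)
    then show ?thesis
      using \<nu>.cdf_nondecreasing[of c c'] \<nu>.cdf_nonneg[of c] c'(1) by simp
  qed
  have nonneg\<nu>: "AE v in \<nu>. 0 \<le> v"
  proof -
    have "AE v in \<nu>. \<not> v \<le> - (1 / Suc n)" for n
    proof -
      have "measure \<nu> {..- (1 / Suc n)} = 0"
        using cdf0[of "- (1 / Suc n)"] by (simp add: cdf_def)
      then show ?thesis
        by (subst (asm) \<nu>.prob_eq_0) (auto elim!: eventually_mono)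
    qed
    then have "AE v in \<nu>. \<forall>n. \<not> v \<le> - (1 / Suc n)" by (simp add: AE_all_countable)
    then show ?thesis
    proof eventually_elim
      case (elim v)
      show ?case
      proof (rule ccontr)
        assume "\<not> 0 \<le> v"
        then obtain n where "1 / Suc n < - v" using nat_approx_posE[of "- v"] by auto
        then show False using elim[rule_format, of n] by linarith
      qed
    qed
  qed
  show thesis
    using that[OF \<nu> nonneg\<nu>] h_L h_eq[OF \<nu> nonneg\<nu>] by simp
qed

text \<open>Passing to sequences makes the weak convergence theory of sequences available for a real index. The
lower bound \<open>c\<close> allows families that consist of probability laws only from \<open>c\<close> on.\<close>

lemma weak_conv_along_at_topI:
  fixes \<mu> :: "real \<Rightarrow> real measure"
  assumes seq: "\<And>X. filterlim X at_top sequentially \<Longrightarrow> (\<And>n. c \<le> X n) \<Longrightarrow> weak_conv_m (\<lambda>n. \<mu> (X n)) \<nu>"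
  shows "weak_conv_along \<mu> \<nu> at_top"
  unfolding weak_conv_along_def
proof (intro allI impI tendsto_at_topI_sequentially)
  fix x and X :: "nat \<Rightarrow> real" assume x: "isCont (cdf \<nu>) x" and X: "filterlim X at_top sequentially"
  let ?Y = "\<lambda>n. max c (X n)"
  have "filterlim ?Y at_top sequentially"
    by (rule filterlim_at_top_mono[OF X]) auto
  then have "(\<lambda>n. cdf (\<mu> (?Y n)) x) \<longlonglongrightarrow> cdf \<nu> x"
    using seq[of ?Y] x by (auto simp: weak_conv_m_def weak_conv_def)
  moreover have "\<forall>\<^sub>F n in sequentially. cdf (\<mu> (?Y n)) x = cdf (\<mu> (X n)) x"
    using X unfolding filterlim_at_top by (auto elim!: allE[of _ c] eventually_mono simp: max_absorb2)
  ultimately show "(\<lambda>n. cdf (\<mu> (X n)) x) \<longlonglongrightarrow> cdf \<nu> x"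
    by (rule Lim_transform_eventually)
qed

lemma weak_conv_along_at_top_of_laplace:
  fixes \<mu> :: "real \<Rightarrow> real measure"
  assumes \<mu>: "\<And>t. c \<le> t \<Longrightarrow> real_distribution (\<mu> t)" "\<And>t. c \<le> t \<Longrightarrow> AE v in \<mu> t. 0 \<le> v"
    and \<nu>: "real_distribution \<nu>" "AE v in \<nu>. 0 \<le> v"
    and conv: "\<And>l. 0 < l \<Longrightarrow> ((\<lambda>t. laplace (\<mu> t) l) \<longlongrightarrow> laplace \<nu> l) at_top"
  shows "weak_conv_along \<mu> \<nu> at_top"
proof (rule weak_conv_along_at_topI)
  fix X :: "nat \<Rightarrow> real" assume X: "filterlim X at_top sequentially" "\<And>n. c \<le> X n"
  show "weak_conv_m (\<lambda>n. \<mu> (X n)) \<nu>"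
    by (rule Laplace_conv_imp_weak_conv) (use X \<mu> \<nu> in \<open>auto intro: filterlim_compose[OF conv]\<close>)
qed

section \<open>The compensated exponential\<close>

definition compensated_exp :: "real \<Rightarrow> real" where
  "compensated_exp v = exp (- v) - 1 + v"

lemma compensated_exp_nonneg: "0 \<le> compensated_exp v"
  using exp_ge_add_one_self[of "- v"] by (simp add: compensated_exp_def)

lemma compensated_exp_pos: "v \<noteq> 0 \<Longrightarrow> 0 < compensated_exp v"
  using exp_minus_greater[of v] by (simp add: compensated_exp_def)

lemma compensated_exp_0 [simp]: "compensated_exp 0 = 0"
  by (simp add: compensated_exp_def)

lemma compensated_exp_le: "0 \<le> v \<Longrightarrow> compensated_exp v \<le> v"
  by (simp add: compensated_exp_def)

lemma compensated_exp_ge: "v - 1 \<le> compensated_exp v"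
  by (simp add: compensated_exp_def)

lemma compensated_exp_le_square:
  assumes "0 \<le> v" shows "compensated_exp v \<le> v\<^sup>2 / 2"
proof -
  let ?g = "\<lambda>v. v\<^sup>2 / 2 - compensated_exp v"
  have "?g 0 \<le> ?g v"
  proof (rule DERIV_nonneg_imp_nondecreasing[OF assms])
    fix w :: real assume "0 \<le> w" "w \<le> v"
    have "(?g has_real_derivative w - (1 - exp (- w))) (at w)"
      unfolding compensated_exp_def by (auto intro!: derivative_eq_intros)
    moreover have "0 \<le> w - (1 - exp (- w))"
      using exp_ge_add_one_self[of "- w"] by simp
    ultimately show "\<exists>y. (?g has_real_derivative y) (at w) \<and> 0 \<le> y" by blast
  qed
  then show ?thesis by simp
qed

text \<open>The two bounds \<open>v\<^sup>2 / 2\<close> and \<open>v\<close> are used for \<open>r \<le> 1\<close> and \<open>r > 1\<close>. The result is the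
dominating function behind every exchange of a limit with the integral over \<open>\<pi>\<close>.\<close>

lemma compensated_exp_mult_le:
  assumes "0 \<le> l" "0 < r"
  shows "compensated_exp (l * r) \<le> (l + l\<^sup>2) * min r (r\<^sup>2)"
proof (cases "r \<le> 1")
  case True
  then have "min r (r\<^sup>2) = r\<^sup>2"
    using assms(2) by (simp add: power2_eq_square mult_left_le min_absorb2)
  moreover have "compensated_exp (l * r) \<le> (l * r)\<^sup>2 / 2"
    using assms by (intro compensated_exp_le_square) simp
  moreover have "(l * r)\<^sup>2 / 2 \<le> (l + l\<^sup>2) * r\<^sup>2"
  proof -
    have "l\<^sup>2 * r\<^sup>2 / 2 \<le> l\<^sup>2 * r\<^sup>2" "0 \<le> l * r\<^sup>2" using assms by auto
    then show ?thesis unfolding power_mult_distrib distrib_right by linarith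
  qed
  ultimately show ?thesis by simp
next
  case False
  then have "min r (r\<^sup>2) = r" by (simp add: power2_eq_square min_absorb1)
  moreover have "compensated_exp (l * r) \<le> l * r"
    using assms by (intro compensated_exp_le) simp
  moreover have "0 \<le> l\<^sup>2 * r" using assms by simp
  ultimately show ?thesis by (simp add: distrib_right)
qed

lemma borel_measurable_compensated_exp [measurable]: "compensated_exp \<in> borel_measurable borel"
  unfolding compensated_exp_def[abs_def] by measurable

lemma compensated_exp_over_square_le:
  assumes "0 < s" "0 < r"
  shows "compensated_exp (s * r) / s\<^sup>2 \<le> r\<^sup>2 / 2" "compensated_exp (s * r) / s\<^sup>2 \<le> r / s"
proof -
  have "compensated_exp (s * r) \<le> (s * r)\<^sup>2 / 2" "compensated_exp (s * r) \<le> s * r"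
    using assms by (intro compensated_exp_le_square compensated_exp_le; simp)+
  then show "compensated_exp (s * r) / s\<^sup>2 \<le> r\<^sup>2 / 2" "compensated_exp (s * r) / s\<^sup>2 \<le> r / s"
    using assms by (auto simp: divide_le_eq power_mult_distrib power2_eq_square mult_ac)
qed

lemma nn_integral_inverse_Icc:
  fixes a c :: real
  assumes "0 < a" "a \<le> 1" "0 \<le> c"
  shows "(\<integral>\<^sup>+s. ennreal (c / s) * indicator {a..1} s \<partial>lborel) = ennreal (- c * ln a)"
proof -
  have "(\<integral>\<^sup>+s. ennreal (c / s) * indicator {a..1} s \<partial>lborel) = ennreal (c * ln 1 - c * ln a)"
    using assms by (intro nn_integral_FTC_Icc) (auto intro!: derivative_eq_intros)
  then show ?thesis by simp
qed

text \<open>Upper half of the estimate of \<open>g(r)\<close>. For \<open>r > 1\<close> the integral is split at \<open>s = 1 / r\<close>: below, the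
integrand is at most \<open>r\<^sup>2 / 2\<close>, which contributes \<open>r / 2\<close>; above, it is at most \<open>r / s\<close>, which
contributes \<open>r ln r\<close>.\<close>

lemma nn_integral_compensated_exp_le:
  assumes r: "0 < r"
  shows "(\<integral>\<^sup>+s. ennreal (compensated_exp (s * r) / s\<^sup>2) * indicator {0<..1} s \<partial>lborel)
    \<le> ennreal (min r (r\<^sup>2) + (if 1 < r then r * ln r else 0))"
proof (cases "1 < r")
  case False
  then have min: "min r (r\<^sup>2) = r\<^sup>2"
    using r by (simp add: power2_eq_square mult_left_le min_absorb2)
  have "(\<integral>\<^sup>+s. ennreal (compensated_exp (s * r) / s\<^sup>2) * indicator {0<..1} s \<partial>lborel)
    \<le> (\<integral>\<^sup>+s. ennreal (r\<^sup>2 / 2) * indicator {0<..1::real} s \<partial>lborel)"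
  proof (rule nn_integral_mono)
    fix s
    show "ennreal (compensated_exp (s * r) / s\<^sup>2) * indicator {0<..1} s
      \<le> ennreal (r\<^sup>2 / 2) * indicator {0<..1} s"
    proof (cases "s \<in> {0<..1}")
      case True
      then have "compensated_exp (s * r) / s\<^sup>2 \<le> r\<^sup>2 / 2"
        using r by (intro compensated_exp_over_square_le) auto
      then show ?thesis by (intro mult_right_mono ennreal_leI) auto
    qed simp
  qed
  also have "\<dots> = ennreal (r\<^sup>2 / 2)"
    by (simp add: nn_integral_cmult_indicator)
  also have "\<dots> \<le> ennreal (r\<^sup>2)" by (rule ennreal_leI) simp
  finally show ?thesis using False by (simp only: min if_False add_0_right)
next
  case True
  then have min: "min r (r\<^sup>2) = r" by (simp add: power2_eq_square min_absorb1)
  have "(\<integral>\<^sup>+s. ennreal (compensated_exp (s * r) / s\<^sup>2) * indicator {0<..1} s \<partial>lborel)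
    \<le> (\<integral>\<^sup>+s. ennreal (r\<^sup>2 / 2) * indicator {0..1 / r} s + ennreal (r / s) * indicator {1 / r..1} s \<partial>lborel)"
  proof (rule nn_integral_mono)
    fix s
    show "ennreal (compensated_exp (s * r) / s\<^sup>2) * indicator {0<..1} s
      \<le> ennreal (r\<^sup>2 / 2) * indicator {0..1 / r} s + ennreal (r / s) * indicator {1 / r..1} s"
    proof (cases "s \<in> {0<..1}")
      case s: True
      then have "0 < s" by simp
      note le = compensated_exp_over_square_le[OF \<open>0 < s\<close> r, THEN ennreal_leI]
      show ?thesis
      proof (cases "s \<le> 1 / r")
        case True
        then have "ennreal (compensated_exp (s * r) / s\<^sup>2) * indicator {0<..1} s
            \<le> ennreal (r\<^sup>2 / 2) * indicator {0..1 / r} s"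
          using s le(1) by (simp add: indicator_def)
        then show ?thesis by (rule order_trans) simp
      next
        case False
        then have "ennreal (compensated_exp (s * r) / s\<^sup>2) * indicator {0<..1} s
            \<le> ennreal (r / s) * indicator {1 / r..1} s"
          using s le(2) by (simp add: indicator_def)
        then show ?thesis by (rule order_trans) simp
      qed
    qed simp
  qed
  also have "\<dots> = ennreal (r\<^sup>2 / 2) * ennreal (1 / r) + ennreal (- r * ln (1 / r))"
    using True
    by (subst nn_integral_add, (measurable)[2], subst nn_integral_inverse_Icc)
      (auto simp: nn_integral_cmult_indicator)
  also have "\<dots> = ennreal (r / 2 + r * ln r)"
    using True by (simp add: ennreal_mult'[symmetric] ennreal_plus[symmetric] ln_div power2_eq_square del: ennreal_plus)
  also have "\<dots> \<le> ennreal (min r (r\<^sup>2) + (if 1 < r then r * ln r else 0))"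
    using True min by (intro ennreal_leI) simp
  finally show ?thesis .
qed

text \<open>Lower half of the estimate of \<open>g(r)\<close>. For \<open>s \<ge> 2 / r\<close> one has \<open>s r - 1 \<ge> s r / 2\<close>, so the integrand
is at least \<open>r / (2 s)\<close> and the integral at least \<open>(r / 2) ln (r / 2)\<close>. The bound \<open>r \<ge> 4\<close> makes
\<open>ln (r / 2)\<close> at least half of \<open>ln r\<close>.\<close>

lemma nn_integral_compensated_exp_ge:
  assumes r: "4 \<le> r"
  shows "ennreal (r * ln r / 4)
    \<le> (\<integral>\<^sup>+s. ennreal (compensated_exp (s * r) / s\<^sup>2) * indicator {0<..1} s \<partial>lborel)"
proof -
  have "2 * ln 2 \<le> ln r"
  proof -
    have "2 * ln 2 = ln (4 :: real)" using ln_realpow[of 2 2] by simp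
    then show ?thesis using r by simp
  qed
  then have "r * (ln r / 4) \<le> r * ((ln r - ln 2) / 2)"
    using r by (intro mult_left_mono) auto
  then have "ennreal (r * ln r / 4) \<le> ennreal (- (r / 2) * ln (2 / r))"
    using r by (intro ennreal_leI) (simp add: ln_div algebra_simps)
  also have "\<dots> = (\<integral>\<^sup>+s. ennreal (r / 2 / s) * indicator {2 / r..1} s \<partial>lborel)"
    using r by (intro nn_integral_inverse_Icc[symmetric]) auto
  also have "\<dots> \<le> (\<integral>\<^sup>+s. ennreal (compensated_exp (s * r) / s\<^sup>2) * indicator {0<..1} s \<partial>lborel)"
  proof (rule nn_integral_mono)
    fix s
    show "ennreal (r / 2 / s) * indicator {2 / r..1} s
      \<le> ennreal (compensated_exp (s * r) / s\<^sup>2) * indicator {0<..1} s"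
    proof (cases "s \<in> {2 / r..1}")
      case True
      have "0 < 2 / r" "2 / r \<le> s" using True r by auto
      then have "0 < s" by (rule less_le_trans)
      with True r have s: "0 < s" "s \<le> 1" "2 \<le> s * r" by (auto simp: divide_le_eq)
      have "s * r / 2 \<le> compensated_exp (s * r)"
        using compensated_exp_ge[of "s * r"] s(3) by linarith
      then have "s * r / 2 / s\<^sup>2 \<le> compensated_exp (s * r) / s\<^sup>2" by (rule divide_right_mono) simp
      then have "r / 2 / s \<le> compensated_exp (s * r) / s\<^sup>2"
        using s(1) by (simp add: power2_eq_square)
      then show ?thesis using s by (auto simp: indicator_def intro: ennreal_leI)
    qed simp
  qed
  finally show ?thesis .
qed

section \<open>The branching mechanism\<close>

context branching_mechanism
begin

abbreviation "\<psi> \<equiv> psi \<alpha> \<sigma> \<pi>"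
abbreviation "\<phi> \<equiv> phi \<alpha> \<sigma> \<pi>"

lemma space_pi: "space \<pi> = {0<..}"
  using sets_eq_imp_space_eq[OF sets_pi] by (simp add: space_restrict_space)

lemma borel_measurable_pi: "f \<in> borel_measurable borel \<Longrightarrow> f \<in> borel_measurable \<pi>"
  unfolding measurable_cong_sets[OF sets_pi refl] by (rule measurable_restrict_space1)

lemma measurable_id_pi [measurable]: "(\<lambda>r. r) \<in> borel_measurable \<pi>"
  by (rule borel_measurable_pi) simp

text \<open>Exhaust \<open>(0, \<infinity>)\<close> by the compact sets \<open>[1 / n, n]\<close>. The property is needed for Tonelli and for
the measurability of \<open>\<psi>\<close>.\<close>

lemma sigma_finite_pi: "sigma_finite_measure \<pi>"
proof
  let ?A = "\<lambda>n::nat. {1 / Suc n..real (Suc n)}"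
  have sub: "?A n \<subseteq> {0<..}" for n by (auto intro: less_le_trans[rotated])
  have "?A n \<in> sets \<pi>" for n
    using sub by (auto simp: sets_pi sets_restrict_space_iff)
  moreover have "emeasure \<pi> (?A n) < \<infinity>" for n
    by (rule radon_pi[OF compact_Icc sub])
  moreover have "(\<Union>n. ?A n) = space \<pi>"
  proof
    show "(\<Union>n. ?A n) \<subseteq> space \<pi>" using sub by (auto simp: space_pi)
    show "space \<pi> \<subseteq> (\<Union>n. ?A n)"
    proof
      fix r assume "r \<in> space \<pi>"
      then have r: "0 < r" by (simp add: space_pi)
      obtain n1 where n1: "1 / Suc n1 < r" using nat_approx_posE[OF r] by auto
      obtain n2 :: nat where n2: "r < n2" using reals_Archimedean2 by blast
      have "1 / Suc (n1 + n2) \<le> 1 / Suc n1" by (intro divide_left_mono) auto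
      then have "r \<in> ?A (n1 + n2)" using n1 n2 by auto
      then show "r \<in> (\<Union>n. ?A n)" by blast
    qed
  qed
  ultimately show "\<exists>A. countable A \<and> A \<subseteq> sets \<pi> \<and> \<Union> A = space \<pi> \<and> (\<forall>a\<in>A. emeasure \<pi> a \<noteq> \<infinity>)"
    by (intro exI[of _ "range ?A"]) (auto simp: less_top[symmetric])
qed

lemma psi_eq: "\<psi> l = \<alpha> * l + 1/2 * \<sigma>\<^sup>2 * l\<^sup>2 + (\<integral>r. compensated_exp (l * r) \<partial>\<pi>)"
  by (simp add: psi_def compensated_exp_def)

lemma AE_pi_pos: "AE r in \<pi>. 0 < r"
  using AE_space[of \<pi>] by (simp add: space_pi)

lemma integrable_compensated_exp:
  assumes "0 \<le> l" shows "integrable \<pi> (\<lambda>r. compensated_exp (l * r))"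
proof (rule Bochner_Integration.integrable_bound)
  show "integrable \<pi> (\<lambda>r. (l + l\<^sup>2) * min r (r\<^sup>2))" using integrable_pi by simp
  show "AE r in \<pi>. norm (compensated_exp (l * r)) \<le> norm ((l + l\<^sup>2) * min r (r\<^sup>2))"
    using AE_pi_pos
  proof eventually_elim
    case (elim r)
    then show ?case
      using compensated_exp_mult_le[OF assms, of r] compensated_exp_nonneg[of "l * r"] by simp
  qed
qed measurable

lemma borel_measurable_psi [measurable]: "\<psi> \<in> borel_measurable borel"
proof -
  interpret sigma_finite_measure \<pi> by (rule sigma_finite_pi)
  show ?thesis unfolding psi_def[abs_def] by measurable
qed

lemma psi_ge: "0 \<le> l \<Longrightarrow> \<alpha> * l \<le> \<psi> l"
  unfolding psi_eq by (simp add: compensated_exp_nonneg integral_nonneg)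

lemma psi_nonneg: "0 \<le> l \<Longrightarrow> 0 \<le> \<psi> l"
  using psi_ge[of l] alpha_nonneg by (meson mult_nonneg_nonneg order_trans)

text \<open>On bounded intervals \<open>\<psi>\<close> grows at most linearly. This keeps the cumulant flow away from \<open>0\<close> in
finite time and makes \<open>\<psi>(s)\<close> comparable to \<open>s\<close> near the origin.\<close>

lemma psi_linear_bound:
  obtains c where "0 < c" "\<And>l. 0 \<le> l \<Longrightarrow> l \<le> C \<Longrightarrow> \<psi> l \<le> c * l"
proof -
  define I where "I = (\<integral>r. min r (r\<^sup>2) \<partial>\<pi>)"
  have I: "0 \<le> I"
    unfolding I_def using AE_pi_pos by (intro integral_nonneg_AE) (auto elim!: eventually_mono)
  have "\<psi> l \<le> (\<alpha> + \<sigma>\<^sup>2 * \<bar>C\<bar> + (1 + \<bar>C\<bar>) * I + 1) * l" if l: "0 \<le> l" "l \<le> C" for l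
  proof -
    have "(\<integral>r. compensated_exp (l * r) \<partial>\<pi>) \<le> (\<integral>r. (l + l\<^sup>2) * min r (r\<^sup>2) \<partial>\<pi>)"
      using AE_pi_pos l integrable_pi
      by (intro integral_mono_AE integrable_compensated_exp)
         (auto elim!: eventually_mono intro: compensated_exp_mult_le)
    also have "\<dots> = (l + l\<^sup>2) * I" by (simp add: I_def)
    also have "\<dots> \<le> ((1 + \<bar>C\<bar>) * l) * I"
      using l I by (intro mult_right_mono) (auto simp: power2_eq_square distrib_right intro: mult_right_mono)
    finally have "(\<integral>r. compensated_exp (l * r) \<partial>\<pi>) \<le> ((1 + \<bar>C\<bar>) * l) * I" .
    moreover have "1/2 * \<sigma>\<^sup>2 * l\<^sup>2 \<le> \<sigma>\<^sup>2 * (\<bar>C\<bar> * l)"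
    proof -
      have "l\<^sup>2 \<le> \<bar>C\<bar> * l" using l by (auto simp: power2_eq_square intro: mult_right_mono)
      then have "\<sigma>\<^sup>2 * l\<^sup>2 \<le> \<sigma>\<^sup>2 * (\<bar>C\<bar> * l)" by (intro mult_left_mono) auto
      moreover have "0 \<le> \<sigma>\<^sup>2 * l\<^sup>2" by simp
      ultimately show ?thesis by linarith
    qed
    ultimately show ?thesis unfolding psi_eq using l by (simp add: algebra_simps)
  qed
  moreover have "0 < \<alpha> + \<sigma>\<^sup>2 * \<bar>C\<bar> + (1 + \<bar>C\<bar>) * I + 1"
    using alpha_nonneg I by (intro add_nonneg_pos add_nonneg_nonneg) auto
  ultimately show thesis using that by blast
qed

text \<open>If \<open>\<psi>\<close> vanished at some \<open>l > 0\<close>, then \<open>\<alpha>\<close> and \<open>\<sigma>\<close> would be zero and \<open>\<pi>\<close> null, so \<open>\<psi>\<close> would vanish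
identically, against \<open>\<psi>(+\<infinity>) = +\<infinity>\<close>.\<close>

lemma psi_pos:
  assumes l: "0 < l" shows "0 < \<psi> l"
proof (rule ccontr)
  assume "\<not> 0 < \<psi> l"
  then have "\<psi> l = 0" using psi_nonneg[of l] l by simp
  moreover have nn: "0 \<le> (\<integral>r. compensated_exp (l * r) \<partial>\<pi>)"
    by (simp add: compensated_exp_nonneg integral_nonneg)
  moreover have "0 \<le> \<alpha> * l" "0 \<le> 1/2 * \<sigma>\<^sup>2 * l\<^sup>2" using alpha_nonneg l by auto
  ultimately have "\<alpha> * l = 0" "1/2 * \<sigma>\<^sup>2 * l\<^sup>2 = 0" and
    int: "(\<integral>r. compensated_exp (l * r) \<partial>\<pi>) = 0"
    unfolding psi_eq by linarith+
  then have "\<alpha> = 0" "\<sigma> = 0" using l by auto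
  have "AE r in \<pi>. compensated_exp (l * r) = 0"
    using int l by (subst (asm) integral_nonneg_eq_0_iff_AE)
      (auto simp: compensated_exp_nonneg intro: integrable_compensated_exp)
  with AE_pi_pos have "AE r in \<pi>. False"
  proof eventually_elim
    case (elim r)
    then show False using compensated_exp_pos[of "l * r"] l by simp
  qed
  then have "(\<integral>r. compensated_exp (k * r) \<partial>\<pi>) = 0" for k
    by (subst integral_cong_AE[where g = "\<lambda>_. 0"]) auto
  then have "\<psi> = (\<lambda>_. 0)"
    unfolding psi_eq[abs_def] by (simp add: \<open>\<alpha> = 0\<close> \<open>\<sigma> = 0\<close>)
  with psi_at_top have "\<forall>\<^sub>F l::real in at_top. (1::real) \<le> 0"
    by (simp add: filterlim_at_top)
  then show False by simp
qed

lemma continuous_on_psi: "continuous_on {0..} \<psi>"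
proof (rule continuous_on_sequentiallyI)
  fix X :: "nat \<Rightarrow> real" and a assume X: "\<forall>n. X n \<in> {0..}" "X \<longlonglongrightarrow> a" and a: "a \<in> {0..}"
  obtain C where C: "\<And>n. \<bar>X n\<bar> \<le> C"
    using convergent_imp_Bseq[OF convergentI[OF X(2)]] by (auto simp: Bseq_def)
  have "(\<lambda>n. \<integral>r. compensated_exp (X n * r) \<partial>\<pi>) \<longlonglongrightarrow> (\<integral>r. compensated_exp (a * r) \<partial>\<pi>)"
  proof (rule integral_dominated_convergence[where w = "\<lambda>r. (C + C\<^sup>2) * min r (r\<^sup>2)"])
    show "AE r in \<pi>. (\<lambda>n. compensated_exp (X n * r)) \<longlonglongrightarrow> compensated_exp (a * r)"
      unfolding compensated_exp_def by (intro AE_I2 tendsto_intros X)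
    show "AE r in \<pi>. norm (compensated_exp (X n * r)) \<le> (C + C\<^sup>2) * min r (r\<^sup>2)" for n
      using AE_pi_pos
    proof eventually_elim
      case (elim r)
      have Xn: "0 \<le> X n" "X n \<le> C" using X(1) C[of n] by auto
      have "compensated_exp (X n * r) \<le> (X n + (X n)\<^sup>2) * min r (r\<^sup>2)"
        using Xn elim by (intro compensated_exp_mult_le)
      also have "\<dots> \<le> (C + C\<^sup>2) * min r (r\<^sup>2)"
        using Xn elim by (intro mult_right_mono add_mono power_mono) auto
      finally show ?case by (simp add: compensated_exp_nonneg)
    qed
  qed (use integrable_pi in auto)
  then show "(\<lambda>n. \<psi> (X n)) \<longlonglongrightarrow> \<psi> a"
    unfolding psi_eq by (intro tendsto_intros X)
qed

lemma isCont_psi: "0 < l \<Longrightarrow> isCont \<psi> l"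
  using continuous_on_interior[OF continuous_on_psi] by (simp add: interior_real_atLeast)

text \<open>The right derivative of \<open>\<psi>\<close> at \<open>0\<close> is \<open>\<alpha>\<close>, by dominated convergence.\<close>

lemma psi_over_id_at_right_0: "((\<lambda>a. \<psi> a / a) \<longlongrightarrow> \<alpha>) (at_right 0)"
  unfolding tendsto_at_iff_sequentially o_def
proof (intro allI impI)
  fix X :: "nat \<Rightarrow> real" assume "\<forall>i. X i \<in> {0<..} - {0}" and lim: "X \<longlonglongrightarrow> 0"
  then have X: "0 < X n" for n by auto
  obtain C where C: "\<And>n. \<bar>X n\<bar> \<le> C"
    using convergent_imp_Bseq[OF convergentI[OF lim]] by (auto simp: Bseq_def)
  have "(\<lambda>n. \<integral>r. compensated_exp (X n * r) / X n \<partial>\<pi>) \<longlonglongrightarrow> (\<integral>r. 0 \<partial>\<pi>)"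
  proof (rule integral_dominated_convergence[where w = "\<lambda>r. (1 + C) * min r (r\<^sup>2)"])
    show "AE r in \<pi>. (\<lambda>n. compensated_exp (X n * r) / X n) \<longlonglongrightarrow> 0"
      using AE_pi_pos
    proof eventually_elim
      case (elim r)
      have b1: "compensated_exp (X n * r) / X n \<le> X n * r\<^sup>2 / 2" for n
      proof -
        have "compensated_exp (X n * r) \<le> (X n * r)\<^sup>2 / 2"
          using X[of n] elim by (intro compensated_exp_le_square) simp
        then show ?thesis using X[of n] by (simp add: divide_simps power2_eq_square mult_ac)
      qed
      have b2: "(\<lambda>n. X n * r\<^sup>2 / 2) \<longlonglongrightarrow> 0"
        using tendsto_mult_left_zero[OF lim, of "r\<^sup>2 / 2"] by (simp only: times_divide_eq_right)
      have b3: "0 \<le> compensated_exp (X n * r) / X n" for n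
        using X[of n] by (simp add: compensated_exp_nonneg)
      show ?case
      proof (rule tendsto_sandwich[OF _ _ tendsto_const b2])
        show "\<forall>\<^sub>F n in sequentially. 0 \<le> compensated_exp (X n * r) / X n"
          by (rule always_eventually) (rule allI, rule b3)
        show "\<forall>\<^sub>F n in sequentially. compensated_exp (X n * r) / X n \<le> X n * r\<^sup>2 / 2"
          by (rule always_eventually) (rule allI, rule b1)
      qed
    qed
    show "AE r in \<pi>. norm (compensated_exp (X n * r) / X n) \<le> (1 + C) * min r (r\<^sup>2)" for n
      using AE_pi_pos
    proof eventually_elim
      case (elim r)
      have Xn: "0 < X n" "X n \<le> C" using X C[of n] by auto
      have "compensated_exp (X n * r) \<le> (X n + (X n)\<^sup>2) * min r (r\<^sup>2)"
        using Xn elim by (intro compensated_exp_mult_le) auto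
      then have "compensated_exp (X n * r) / X n \<le> (1 + X n) * min r (r\<^sup>2)"
        using Xn by (simp add: divide_le_eq power2_eq_square algebra_simps)
      also have "\<dots> \<le> (1 + C) * min r (r\<^sup>2)"
        using Xn elim by (intro mult_right_mono) auto
      finally show ?case using Xn by (simp add: compensated_exp_nonneg)
    qed
  qed (use integrable_pi in auto)
  then have "(\<lambda>n. \<alpha> + 1/2 * \<sigma>\<^sup>2 * X n + (\<integral>r. compensated_exp (X n * r) / X n \<partial>\<pi>))
      \<longlonglongrightarrow> \<alpha> + 1/2 * \<sigma>\<^sup>2 * 0 + 0"
    by (intro tendsto_intros lim) simp
  moreover have "\<psi> (X n) / X n = \<alpha> + 1/2 * \<sigma>\<^sup>2 * X n + (\<integral>r. compensated_exp (X n * r) / X n \<partial>\<pi>)" for n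
    using X[of n] by (simp add: psi_eq field_simps power2_eq_square)
  ultimately show "(\<lambda>n. \<psi> (X n) / X n) \<longlonglongrightarrow> \<alpha>" by simp
qed

lemma set_integrable_inverse_psi:
  assumes l: "0 < l" shows "set_integrable lborel {l..} (\<lambda>v. 1 / \<psi> v)"
proof -
  obtain c where c: "1 < c" "set_integrable lborel {c..} (\<lambda>v. 1 / \<psi> v)"
    using inverse_psi_integrable by blast
  have "continuous_on {l..c} (\<lambda>v. 1 / \<psi> v)"
    using l psi_pos by (intro continuous_intros continuous_on_subset[OF continuous_on_psi])
      (auto simp: less_le_trans less_imp_neq[symmetric])
  then have "set_integrable lborel {l..c} (\<lambda>v. 1 / \<psi> v)"
    by (rule borel_integrable_atLeastAtMost')
  then have "set_integrable lborel ({l..c} \<union> {c..}) (\<lambda>v. 1 / \<psi> v)"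
    using c by (intro set_integrable_Un) auto
  then show ?thesis by (rule set_integrable_subset) auto
qed

lemma phi_nonneg: "0 < l \<Longrightarrow> 0 \<le> \<phi> l"
  unfolding phi_def set_lebesgue_integral_def
  by (intro Bochner_Integration.integral_nonneg) (auto simp: indicator_def psi_nonneg)

lemma DERIV_phi:
  assumes l: "0 < l" shows "(\<phi> has_real_derivative - (1 / \<psi> l)) (at l)"
proof -
  define a where "a = l / 2"
  define b where "b = l + 1"
  have ab: "0 < a" "a < l" "l < b" using l by (auto simp: a_def b_def)
  have eq: "\<phi> v = \<phi> a - integral {a..v} (\<lambda>v. 1 / \<psi> v)" if "v \<in> {a..b}" for v
  proof -
    have "\<phi> a = (LBINT w:{a..v} \<union> {v..}. 1 / \<psi> w)"
      unfolding phi_def using that by (intro arg_cong2[where f = "set_lebesgue_integral lborel"]) auto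
    also have "\<dots> = (LBINT w:{a..v}. 1 / \<psi> w) + \<phi> v"
      unfolding phi_def using ab that AE_lborel_singleton[of v]
      by (intro set_integral_Un_AE)
        (auto intro!: set_integrable_subset[OF set_integrable_inverse_psi[OF ab(1)]] elim!: eventually_mono)
    also have "(LBINT w:{a..v}. 1 / \<psi> w) = integral {a..v} (\<lambda>v. 1 / \<psi> v)"
      by (intro set_borel_integral_eq_integral)
        (auto intro!: set_integrable_subset[OF set_integrable_inverse_psi[OF ab(1)]])
    finally show ?thesis by simp
  qed
  have "continuous_on {a..b} (\<lambda>v. 1 / \<psi> v)"
    using ab psi_pos by (intro continuous_intros continuous_on_subset[OF continuous_on_psi])
      (auto simp: less_le_trans less_imp_neq[symmetric])
  then have "((\<lambda>v. integral {a..v} (\<lambda>v. 1 / \<psi> v)) has_real_derivative 1 / \<psi> l) (at l within {a..b})"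
    using ab by (intro integral_has_real_derivative) auto
  then have "((\<lambda>v. \<phi> a - integral {a..v} (\<lambda>v. 1 / \<psi> v)) has_real_derivative - (1 / \<psi> l)) (at l within {a..b})"
    by (rule DERIV_cong[OF DERIV_diff[OF DERIV_const]]) simp
  then have "(\<phi> has_real_derivative - (1 / \<psi> l)) (at l within {a..b})"
    by (rule has_field_derivative_transform_within[OF _ zero_less_one]) (use ab in simp, rule eq[symmetric])
  then show ?thesis using ab by (simp add: at_within_Icc_at)
qed

lemma continuous_on_phi: "continuous_on {0<..} \<phi>"
  by (intro continuous_at_imp_continuous_on ballI DERIV_isCont[OF DERIV_phi]) simp

lemma phi_strict_antimono:
  assumes "0 < a" "a < b" shows "\<phi> b < \<phi> a"
proof (rule DERIV_neg_imp_decreasing[OF assms(2)])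
  fix x assume "a \<le> x" "x \<le> b"
  then have "0 < x" using assms by simp
  then show "\<exists>y. (\<phi> has_real_derivative y) (at x) \<and> y < 0"
    using DERIV_phi[of x] psi_pos[of x] by (intro exI[of _ "- (1 / \<psi> x)"]) auto
qed

lemma phi_inj: "inj_on \<phi> {0<..}"
  by (rule linorder_inj_onI) (use phi_strict_antimono in \<open>force+\<close>)

lemma phi_inv_phi: "0 < l \<Longrightarrow> phi_inv \<alpha> \<sigma> \<pi> (\<phi> l) = l"
  unfolding phi_inv_def by (rule the_inv_into_f_f[OF phi_inj]) simp

end

section \<open>The logarithmic moment as an integral at the origin\<close>

context branching_mechanism
begin

text \<open>The distance of \<open>\<psi>\<close> from its tangent at the origin, on the quadratic scale; its integral over
\<open>(0, 1]\<close> detects the logarithmic moment.\<close>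

definition excess :: "real \<Rightarrow> real" where
  "excess s = (\<psi> s - \<alpha> * s) / s\<^sup>2"

lemma borel_measurable_excess [measurable]: "excess \<in> borel_measurable borel"
  unfolding excess_def[abs_def] by measurable

lemma excess_nonneg: "0 \<le> s \<Longrightarrow> 0 \<le> excess s"
  unfolding excess_def using psi_ge[of s] by simp

lemma ennreal_excess:
  assumes s: "0 < s"
  shows "ennreal (excess s) = ennreal (\<sigma>\<^sup>2 / 2) + (\<integral>\<^sup>+r. ennreal (compensated_exp (s * r) / s\<^sup>2) \<partial>\<pi>)"
proof -
  have int: "integrable \<pi> (\<lambda>r. compensated_exp (s * r) / s\<^sup>2)"
    using s by (intro integrable_divide integrable_compensated_exp) simp
  have nn: "0 \<le> (\<integral>r. compensated_exp (s * r) / s\<^sup>2 \<partial>\<pi>)"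
    by (intro Bochner_Integration.integral_nonneg) (simp add: compensated_exp_nonneg)
  have "excess s = \<sigma>\<^sup>2 / 2 + (\<integral>r. compensated_exp (s * r) / s\<^sup>2 \<partial>\<pi>)"
    using s by (simp add: excess_def psi_eq field_simps)
  then show ?thesis
    using nn int by (simp add: nn_integral_eq_integral compensated_exp_nonneg)
qed

lemma nn_integral_excess:
  "(\<integral>\<^sup>+s. ennreal (excess s) * indicator {0<..1} s \<partial>lborel) = ennreal (\<sigma>\<^sup>2 / 2) +
    (\<integral>\<^sup>+r. \<integral>\<^sup>+s. ennreal (compensated_exp (s * r) / s\<^sup>2) * indicator {0<..1} s \<partial>lborel \<partial>\<pi>)"
proof -
  interpret \<pi>: sigma_finite_measure \<pi> by (rule sigma_finite_pi)
  interpret pair_sigma_finite \<pi> lborel ..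
  let ?k = "\<lambda>r s. ennreal (compensated_exp (s * r) / s\<^sup>2) * indicator {0<..1} s"
  have "(\<integral>\<^sup>+s. ennreal (excess s) * indicator {0<..1} s \<partial>lborel)
      = (\<integral>\<^sup>+s. ennreal (\<sigma>\<^sup>2 / 2) * indicator {0<..1} s + (\<integral>\<^sup>+r. ?k r s \<partial>\<pi>) \<partial>lborel)"
    by (intro nn_integral_cong)
      (auto simp: ennreal_excess indicator_def)
  also have "\<dots> = ennreal (\<sigma>\<^sup>2 / 2) + (\<integral>\<^sup>+s. \<integral>\<^sup>+r. ?k r s \<partial>\<pi> \<partial>lborel)"
    by (subst nn_integral_add) (auto simp: nn_integral_cmult_indicator)
  also have "(\<integral>\<^sup>+s. \<integral>\<^sup>+r. ?k r s \<partial>\<pi> \<partial>lborel) = (\<integral>\<^sup>+r. \<integral>\<^sup>+s. ?k r s \<partial>lborel \<partial>\<pi>)"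
    by (intro Fubini') measurable
  finally show ?thesis .
qed

lemma log_moment_imp_nn_integral_excess_finite:
  assumes "log_moment_condition \<alpha> \<pi>"
  shows "(\<integral>\<^sup>+s. ennreal (excess s) * indicator {0<..1} s \<partial>lborel) < \<infinity>"
proof -
  obtain c where c: "1 < c" "set_integrable \<pi> {c..} (\<lambda>r. r * ln r)"
    using assms by (auto simp: log_moment_condition_def)
  let ?w = "\<lambda>r. (1 + ln c) * min r (r\<^sup>2) + indicator {c..} r *\<^sub>R (r * ln r)"
  have intw: "integrable \<pi> ?w"
    using integrable_pi c(2) by (auto simp: set_integrable_def)
  \<comment> \<open>The logarithm is bounded by \<open>ln c\<close> on \<open>(1, c)\<close>, where the condition gives no integrability.\<close>
  have wbound: "min r (r\<^sup>2) + (if 1 < r then r * ln r else 0) \<le> ?w r" if r: "0 < r" for r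
  proof (cases "1 < r")
    case True
    then have min: "min r (r\<^sup>2) = r" by (simp add: power2_eq_square min_absorb1)
    show ?thesis
    proof (cases "c \<le> r")
      case True
      then show ?thesis using c(1) r \<open>1 < r\<close> unfolding min by (simp add: distrib_right)
    next
      case False
      then have "r * ln r \<le> r * ln c" using \<open>1 < r\<close> by (intro mult_left_mono) auto
      then show ?thesis using False \<open>1 < r\<close> unfolding min by (simp add: algebra_simps)
    qed
  next
    case False
    then show ?thesis using c(1) r by (simp add: algebra_simps)
  qed
  have "(\<integral>\<^sup>+r. \<integral>\<^sup>+s. ennreal (compensated_exp (s * r) / s\<^sup>2) * indicator {0<..1} s \<partial>lborel \<partial>\<pi>)
      \<le> (\<integral>\<^sup>+r. ennreal (?w r) \<partial>\<pi>)"
  proof (rule nn_integral_mono)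
    fix r assume "r \<in> space \<pi>"
    then have r: "0 < r" by (simp add: space_pi)
    show "(\<integral>\<^sup>+s. ennreal (compensated_exp (s * r) / s\<^sup>2) * indicator {0<..1} s \<partial>lborel) \<le> ennreal (?w r)"
      by (rule order_trans[OF nn_integral_compensated_exp_le[OF r] ennreal_leI[OF wbound[OF r]]])
  qed
  also have "\<dots> < \<infinity>"
  proof -
    have "(\<integral>\<^sup>+r. ennreal (?w r) \<partial>\<pi>) \<le> (\<integral>\<^sup>+r. ennreal (norm (?w r)) \<partial>\<pi>)"
      by (intro nn_integral_mono ennreal_leI) simp
    also have "\<dots> < \<infinity>" using intw unfolding integrable_iff_bounded by blast
    finally show ?thesis .
  qed
  finally show ?thesis unfolding nn_integral_excess by (simp add: ennreal_add_less_top)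
qed

lemma nn_integral_excess_finite_imp_log_moment:
  assumes fin: "(\<integral>\<^sup>+s. ennreal (excess s) * indicator {0<..1} s \<partial>lborel) < \<infinity>" and "0 < \<alpha>"
  shows "log_moment_condition \<alpha> \<pi>"
proof -
  have fin2: "(\<integral>\<^sup>+r. \<integral>\<^sup>+s. ennreal (compensated_exp (s * r) / s\<^sup>2) * indicator {0<..1} s \<partial>lborel \<partial>\<pi>) < \<infinity>"
    using fin unfolding nn_integral_excess by (simp add: ennreal_add_less_top)
  have [measurable]: "(\<lambda>r. indicator {4..} r * (r * ln r)) \<in> borel_measurable \<pi>"
    by (rule borel_measurable_pi) measurable
  have "(\<integral>\<^sup>+r. ennreal (norm (indicator {4..} r * (r * ln r) / 4)) \<partial>\<pi>)
     \<le> (\<integral>\<^sup>+r. \<integral>\<^sup>+s. ennreal (compensated_exp (s * r) / s\<^sup>2) * indicator {0<..1} s \<partial>lborel \<partial>\<pi>)"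
  proof (rule nn_integral_mono)
    fix r
    show "ennreal (norm (indicator {4..} r * (r * ln r) / 4))
      \<le> (\<integral>\<^sup>+s. ennreal (compensated_exp (s * r) / s\<^sup>2) * indicator {0<..1} s \<partial>lborel)"
    proof (cases "4 \<le> r")
      case True
      then show ?thesis using nn_integral_compensated_exp_ge[OF True] by simp
    qed simp
  qed
  also note fin2
  finally have "integrable \<pi> (\<lambda>r. indicator {4..} r * (r * ln r) / 4)"
    by (intro integrableI_bounded) auto
  then have "integrable \<pi> (\<lambda>r. 4 * (indicator {4..} r * (r * ln r) / 4))"
    by (rule integrable_mult_right)
  then have "set_integrable \<pi> {4..} (\<lambda>r. r * ln r)"
    unfolding set_integrable_def by simp
  then show ?thesis unfolding log_moment_condition_def using \<open>0 < \<alpha>\<close> by (intro conjI exI[of _ 4]) auto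
qed

end

section \<open>The tilted branching mechanism and its limit at the origin\<close>

lemma mono_tendsto_Inf_at_right:
  fixes f :: "real \<Rightarrow> real"
  assumes mono: "\<And>a b. c < a \<Longrightarrow> a \<le> b \<Longrightarrow> f a \<le> f b" and bdd: "bdd_below (f ` {c<..})"
  shows "(f \<longlongrightarrow> (INF a\<in>{c<..}. f a)) (at_right c)"
proof (rule order_tendstoI)
  fix y assume y: "y < (INF a\<in>{c<..}. f a)"
  have "y < f a" if "c < a" for a
    using y cINF_lower[OF bdd, of a] that by simp
  then show "\<forall>\<^sub>F a in at_right c. y < f a"
    using eventually_at_right_less[of c] by (auto elim!: eventually_mono)
next
  fix y assume y: "(INF a\<in>{c<..}. f a) < y"
  then obtain b where b: "c < b" "f b < y"
    using cINF_less_iff[OF _ bdd] by (auto simp: greaterThan_non_empty)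
  show "\<forall>\<^sub>F a in at_right c. f a < y"
    using b mono unfolding eventually_at_right_field
    by (intro exI[of _ b]) (auto intro: le_less_trans[OF _ b(2)])
qed

context branching_mechanism
begin

text \<open>The function \<open>K\<close> of the introduction, a primitive of
\<open>(\<psi>(a) - \<alpha> a) / (a \<psi>(a))\<close>.\<close>

definition log_potential :: "real \<Rightarrow> real" where
  "log_potential a = ln a + \<alpha> * \<phi> a"

text \<open>The function \<open>H\<close> of the introduction. Its logarithmic derivative is
\<open>(\<psi>' - \<alpha>) / \<psi>\<close>, the integrand in the exponent of the limit law.\<close>

definition tilted_psi :: "real \<Rightarrow> real" where
  "tilted_psi a = \<psi> a * exp (\<alpha> * \<phi> a)"

lemma tilted_psi_eq: "0 < a \<Longrightarrow> tilted_psi a = \<psi> a / a * exp (log_potential a)"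
  by (simp add: tilted_psi_def log_potential_def exp_add)

lemma DERIV_log_potential:
  assumes a: "0 < a"
  shows "(log_potential has_real_derivative excess a * (a / \<psi> a)) (at a)"
proof -
  have "(log_potential has_real_derivative 1 / a + \<alpha> * - (1 / \<psi> a)) (at a)"
    unfolding log_potential_def[abs_def]
    using a DERIV_ln_divide[OF a] DERIV_cmult[OF DERIV_phi[OF a]] by (intro DERIV_add)
  moreover have "1 / a + \<alpha> * - (1 / \<psi> a) = excess a * (a / \<psi> a)"
    using a psi_pos[OF a] by (simp add: excess_def field_simps power2_eq_square)
  ultimately show ?thesis by simp
qed

lemma log_potential_mono:
  assumes "0 < a" "a \<le> b" shows "log_potential a \<le> log_potential b"
proof (rule DERIV_nonneg_imp_nondecreasing[OF assms(2)])
  fix x assume "a \<le> x" "x \<le> b"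
  then have x: "0 < x" using assms by simp
  then have "0 \<le> excess x * (x / \<psi> x)"
    using excess_nonneg[of x] psi_pos[OF x] by simp
  then show "\<exists>y. (log_potential has_real_derivative y) (at x) \<and> 0 \<le> y"
    using DERIV_log_potential[OF x] by blast
qed

lemma nn_integral_DERIV_log_potential:
  assumes "0 < a" "a \<le> 1"
  shows "(\<integral>\<^sup>+s. ennreal (excess s * (s / \<psi> s)) * indicator {a..1} s \<partial>lborel)
    = ennreal (log_potential 1 - log_potential a)"
proof (rule nn_integral_FTC_Icc)
  fix x assume x: "x \<in> {a..1}"
  then have "0 < x" using assms by auto
  then show "(log_potential has_real_derivative excess x * (x / \<psi> x)) (at x)"
    by (rule DERIV_log_potential)
  show "0 \<le> excess x * (x / \<psi> x)"
    using \<open>0 < x\<close> excess_nonneg[of x] psi_pos[of x] by simp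
next
  show "(\<lambda>s. excess s * (s / \<psi> s)) \<in> borel_measurable borel" by measurable
qed (fact assms(2))

text \<open>On \<open>(0, 1]\<close> one has \<open>\<alpha> s \<le> \<psi>(s) \<le> c s\<close>, so \<open>K'\<close> is comparable to the excess. One direction
integrates this comparison over \<open>[a, 1]\<close> with a bound uniform in \<open>a\<close>; the other lets
\<open>a = 1 / n\<close> decrease to \<open>0\<close> by monotone convergence.\<close>

lemma log_potential_bdd_below_iff:
  assumes \<alpha>: "0 < \<alpha>"
  shows "(\<exists>B. \<forall>a\<in>{0<..1}. B \<le> log_potential a) \<longleftrightarrow> log_moment_condition \<alpha> \<pi>"
proof
  assume "log_moment_condition \<alpha> \<pi>"
  then have fin: "(\<integral>\<^sup>+s. ennreal (excess s) * indicator {0<..1} s \<partial>lborel) < \<infinity>" (is "?J < \<infinity>")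
    by (rule log_moment_imp_nn_integral_excess_finite)
  have "log_potential 1 - enn2real (ennreal (1 / \<alpha>) * ?J) \<le> log_potential a" if a: "a \<in> {0<..1}" for a
  proof -
    have "ennreal (log_potential 1 - log_potential a)
        = (\<integral>\<^sup>+s. ennreal (excess s * (s / \<psi> s)) * indicator {a..1} s \<partial>lborel)"
      using a by (intro nn_integral_DERIV_log_potential[symmetric]) auto
    also have "\<dots> \<le> (\<integral>\<^sup>+s. ennreal (1 / \<alpha>) * (ennreal (excess s) * indicator {0<..1} s) \<partial>lborel)"
    proof (rule nn_integral_mono)
      fix s
      show "ennreal (excess s * (s / \<psi> s)) * indicator {a..1} s
        \<le> ennreal (1 / \<alpha>) * (ennreal (excess s) * indicator {0<..1} s)"
      proof (cases "s \<in> {a..1}")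
        case True
        then have s: "0 < s" "s \<le> 1" using a by auto
        have "s / \<psi> s \<le> 1 / \<alpha>"
          using psi_ge[of s] psi_pos[OF s(1)] s \<alpha> by (simp add: field_simps)
        then have "excess s * (s / \<psi> s) \<le> excess s * (1 / \<alpha>)"
          using s by (intro mult_left_mono excess_nonneg) auto
        then have "ennreal (excess s * (s / \<psi> s)) \<le> ennreal (1 / \<alpha>) * ennreal (excess s)"
          using \<alpha> s by (subst ennreal_mult[symmetric]) (auto intro!: ennreal_leI excess_nonneg simp: mult.commute)
        then show ?thesis using True s by simp
      qed simp
    qed
    also have "\<dots> = ennreal (1 / \<alpha>) * ?J"
      by (rule nn_integral_cmult) simp
    finally have le: "ennreal (log_potential 1 - log_potential a) \<le> ennreal (1 / \<alpha>) * ?J" .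
    have "ennreal (1 / \<alpha>) * ?J < \<infinity>"
      using fin by (simp add: ennreal_mult_less_top)
    with le have "enn2real (ennreal (log_potential 1 - log_potential a)) \<le> enn2real (ennreal (1 / \<alpha>) * ?J)"
      by (intro enn2real_mono) auto
    moreover have "0 \<le> log_potential 1 - log_potential a"
      using log_potential_mono[of a 1] a by simp
    ultimately show ?thesis by simp
  qed
  then show "\<exists>B. \<forall>a\<in>{0<..1}. B \<le> log_potential a" by blast
next
  assume "\<exists>B. \<forall>a\<in>{0<..1}. B \<le> log_potential a"
  then obtain B where B: "\<And>a. a \<in> {0<..1} \<Longrightarrow> B \<le> log_potential a" by blast
  obtain c where c: "0 < c" "\<And>l. 0 \<le> l \<Longrightarrow> l \<le> 1 \<Longrightarrow> \<psi> l \<le> c * l"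
    using psi_linear_bound[of 1] by blast
  define J where "J n s = ennreal (excess s) * indicator {1 / Suc n..1} s" for n :: nat and s
  have J_le: "(\<integral>\<^sup>+s. J n s \<partial>lborel) \<le> ennreal (c * (log_potential 1 - B))" for n
  proof -
    have n: "0 < 1 / real (Suc n)" "1 / real (Suc n) \<le> 1" by auto
    have "(\<integral>\<^sup>+s. J n s \<partial>lborel)
      \<le> (\<integral>\<^sup>+s. ennreal c * (ennreal (excess s * (s / \<psi> s)) * indicator {1 / Suc n..1} s) \<partial>lborel)"
    proof (rule nn_integral_mono)
      fix s
      show "J n s \<le> ennreal c * (ennreal (excess s * (s / \<psi> s)) * indicator {1 / Suc n..1} s)"
      proof (cases "s \<in> {1 / Suc n..1}")
        case True
        then have s: "0 < s" "s \<le> 1" using n by (auto intro: less_le_trans[OF n(1)])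
        have "1 \<le> c * (s / \<psi> s)"
          using c(2)[of s] psi_pos[OF s(1)] s by (simp add: field_simps)
        then have "excess s * 1 \<le> excess s * (c * (s / \<psi> s))"
          using s by (intro mult_left_mono excess_nonneg) auto
        then have "ennreal (excess s) \<le> ennreal (c * (excess s * (s / \<psi> s)))"
          by (intro ennreal_leI) (simp only: mult_1_right mult.left_commute)
        also have "\<dots> = ennreal c * ennreal (excess s * (s / \<psi> s))"
          using c(1) s psi_pos[OF s(1)] excess_nonneg[of s] by (intro ennreal_mult) auto
        finally show ?thesis using True by (simp add: J_def)
      qed (simp add: J_def)
    qed
    also have "\<dots> = ennreal c * ennreal (log_potential 1 - log_potential (1 / Suc n))"
      by (subst nn_integral_cmult) (simp, simp only: nn_integral_DERIV_log_potential[OF n])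
    also have "\<dots> = ennreal (c * (log_potential 1 - log_potential (1 / Suc n)))"
      using c(1) log_potential_mono[OF n] by (intro ennreal_mult[symmetric]) auto
    also have "\<dots> \<le> ennreal (c * (log_potential 1 - B))"
      using B[of "1 / Suc n"] n c(1) by (intro ennreal_leI mult_left_mono) auto
    finally show ?thesis .
  qed
  have "(\<integral>\<^sup>+s. ennreal (excess s) * indicator {0<..1} s \<partial>lborel) = (\<integral>\<^sup>+s. (SUP n. J n s) \<partial>lborel)"
  proof (rule nn_integral_cong)
    fix s :: real
    show "ennreal (excess s) * indicator {0<..1} s = (SUP n. J n s)"
    proof (rule antisym)
      show "ennreal (excess s) * indicator {0<..1} s \<le> (SUP n. J n s)"
      proof (cases "s \<in> {0<..1}")
        case True
        then obtain n where "1 / Suc n < s" using nat_approx_posE[of s] by auto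
        then have "ennreal (excess s) * indicator {0<..1} s = J n s"
          using True by (simp add: J_def)
        then show ?thesis by (metis SUP_upper UNIV_I)
      qed simp
      have "J n s \<le> ennreal (excess s) * indicator {0<..1} s" for n
      proof -
        have "s \<in> {1 / Suc n..1} \<Longrightarrow> s \<in> {0<..1}" by (auto intro: less_le_trans[rotated])
        then show ?thesis by (cases "s \<in> {1 / Suc n..1}") (auto simp: J_def)
      qed
      then show "(SUP n. J n s) \<le> ennreal (excess s) * indicator {0<..1} s" by (rule SUP_least)
    qed
  qed
  also have "\<dots> = (SUP n. \<integral>\<^sup>+s. J n s \<partial>lborel)"
  proof (rule nn_integral_monotone_convergence_SUP)
    show "incseq J"
    proof (intro incseq_SucI le_funI)
      fix n and s :: real
      have "1 / real (Suc (Suc n)) \<le> 1 / real (Suc n)" by (simp add: frac_le)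
      then have "indicator {1 / Suc n..1} s \<le> (indicator {1 / Suc (Suc n)..1} s :: ennreal)"
        by (auto simp: indicator_def)
      then show "J n s \<le> J (Suc n) s" unfolding J_def by (rule mult_left_mono) simp
    qed
  qed (auto simp: J_def)
  also have "\<dots> \<le> ennreal (c * (log_potential 1 - B))"
    by (rule SUP_least) (rule J_le)
  also have "\<dots> < \<infinity>" by simp
  finally show "log_moment_condition \<alpha> \<pi>"
    using \<alpha> by (rule nn_integral_excess_finite_imp_log_moment)
qed

lemma tilted_psi_pos: "0 < l \<Longrightarrow> 0 < tilted_psi l"
  by (simp add: tilted_psi_def psi_pos)

lemma isCont_tilted_psi: "0 < l \<Longrightarrow> isCont tilted_psi l"
  unfolding tilted_psi_def[abs_def]
  by (intro continuous_intros isCont_psi DERIV_isCont[OF DERIV_phi])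

lemma psi_le_tilted_psi: "0 < l \<Longrightarrow> \<psi> l \<le> tilted_psi l"
  unfolding tilted_psi_def using psi_pos[of l] phi_nonneg[of l] alpha_nonneg
  by (simp add: mult_le_cancel_left1)

text \<open>The limit is \<open>h = \<alpha> k\<close>, where \<open>k\<close> is the infimum of \<open>exp K\<close> and, by monotonicity, its limit at the
origin. So \<open>h > 0\<close> amounts to \<open>\<alpha> > 0\<close> together with a lower bound for \<open>K\<close>, and these correspond to the
two parts of the logarithmic moment condition.\<close>

lemma tilted_psi_tendsto_at_right_0:
  obtains h where "0 \<le> h" "(tilted_psi \<longlongrightarrow> h) (at_right 0)"
    "0 < h \<longleftrightarrow> log_moment_condition \<alpha> \<pi>"
proof -
  let ?E = "\<lambda>a. exp (log_potential a)"
  define k where "k = (INF a\<in>{0<..}. ?E a)"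
  have bdd: "bdd_below (?E ` {0<..})" by (intro bdd_belowI2[where m = 0]) simp
  have k_lim: "(?E \<longlongrightarrow> k) (at_right 0)"
    unfolding k_def by (rule mono_tendsto_Inf_at_right[OF _ bdd]) (simp add: log_potential_mono)
  have k_le: "k \<le> ?E a" if "0 < a" for a
    unfolding k_def using that by (intro cINF_lower[OF bdd]) simp
  have k_nonneg: "0 \<le> k" unfolding k_def by (intro cINF_greatest) auto
  have "((\<lambda>a. \<psi> a / a * ?E a) \<longlongrightarrow> \<alpha> * k) (at_right 0)"
    by (intro tendsto_mult psi_over_id_at_right_0 k_lim)
  moreover have "\<forall>\<^sub>F a in at_right 0. \<psi> a / a * ?E a = tilted_psi a"
    using eventually_at_right_less[of "0::real"] by eventually_elim (simp add: tilted_psi_eq)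
  ultimately have lim: "(tilted_psi \<longlongrightarrow> \<alpha> * k) (at_right 0)"
    by (rule Lim_transform_eventually)
  have iff: "0 < k \<longleftrightarrow> log_moment_condition \<alpha> \<pi>" if \<alpha>: "0 < \<alpha>"
  proof -
    have "0 < k \<longleftrightarrow> (\<exists>B. \<forall>a\<in>{0<..1}. B \<le> log_potential a)"
    proof
      assume "0 < k"
      then have "ln k \<le> log_potential a" if "0 < a" for a
        using ln_le_cancel_iff[OF \<open>0 < k\<close>, of "exp (log_potential a)"] k_le[OF that] by simp
      then show "\<exists>B. \<forall>a\<in>{0<..1}. B \<le> log_potential a" by (intro exI[of _ "ln k"]) auto
    next
      assume "\<exists>B. \<forall>a\<in>{0<..1}. B \<le> log_potential a"
      then obtain B where B: "\<And>a. a \<in> {0<..1} \<Longrightarrow> B \<le> log_potential a" by blast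
      have "B \<le> log_potential a" if "0 < a" for a
        using B[of "min a 1"] log_potential_mono[of "min a 1" a] that by auto
      then have "exp B \<le> k" unfolding k_def by (intro cINF_greatest) auto
      then show "0 < k" using exp_gt_zero less_le_trans by blast
    qed
    then show ?thesis using log_potential_bdd_below_iff[OF \<alpha>] by simp
  qed
  have "0 < \<alpha> * k \<longleftrightarrow> log_moment_condition \<alpha> \<pi>"
  proof (cases "0 < \<alpha>")
    case True
    then show ?thesis using iff by (simp add: zero_less_mult_iff)
  next
    case False
    then show ?thesis using alpha_nonneg by (simp add: log_moment_condition_def)
  qed
  then show thesis using that[OF _ lim] alpha_nonneg k_nonneg by simp
qed

end

section \<open>Differentiating a Laplace transform\<close>

lemma abs_diff_exp_le:
  fixes m a b z :: real
  assumes "0 \<le> z" "m \<le> a" "m \<le> b"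
  shows "\<bar>exp (- a * z) - exp (- b * z)\<bar> \<le> \<bar>a - b\<bar> * (z * exp (- m * z))"
proof -
  have le: "exp (- a * z) - exp (- b * z) \<le> (b - a) * (z * exp (- m * z))"
    if "m \<le> a" "a \<le> b" for a b :: real
  proof -
    have "exp (- a * z) - exp (- b * z) = exp (- a * z) * (1 - exp (- ((b - a) * z)))"
      by (simp add: right_diff_distrib exp_add[symmetric] algebra_simps)
    also have "\<dots> \<le> exp (- a * z) * ((b - a) * z)"
      using exp_ge_add_one_self[of "- ((b - a) * z)"] by (intro mult_left_mono) auto
    also have "\<dots> \<le> exp (- m * z) * ((b - a) * z)"
      using that assms(1) by (intro mult_right_mono) (auto intro: mult_right_mono)
    finally show ?thesis by (simp add: mult_ac)
  qed
  show ?thesis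
  proof (cases "a \<le> b")
    case True
    then have "exp (- b * z) \<le> exp (- a * z)" using assms(1) by (simp add: mult_right_mono)
    then show ?thesis using le[OF assms(2) True] True by (simp only: abs_of_nonneg abs_minus_commute[of a b], simp?)
  next
    case False
    then have "exp (- a * z) \<le> exp (- b * z)" using assms(1) by (simp add: mult_right_mono)
    then show ?thesis using le[OF assms(3)] False by (simp only: abs_minus_commute[of "exp (- a * z)"], simp?)
  qed
qed

lemma mult_exp_neg_le:
  fixes z :: real
  assumes "0 < m" shows "z * exp (- m * z) \<le> 1 / m"
proof -
  have "m * z \<le> exp (m * z)" using exp_ge_add_one_self[of "m * z"] by linarith
  then have "m * z * exp (- (m * z)) \<le> exp (m * z) * exp (- (m * z))" by (rule mult_right_mono) simp
  also have "\<dots> = 1" by (simp add: exp_minus)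
  finally show ?thesis using assms by (simp add: field_simps)
qed

text \<open>Difference quotients at points above \<open>l / 2\<close> are bounded by \<open>X exp(- (l / 2) X) \<le> 2 / l\<close>, so
dominated convergence applies without any moment assumption on \<open>X\<close>.\<close>

lemma (in prob_space) DERIV_expectation_exp:
  fixes X :: "'a \<Rightarrow> real"
  assumes X [measurable]: "X \<in> borel_measurable M" and nonneg: "\<And>\<omega>. \<omega> \<in> space M \<Longrightarrow> 0 \<le> X \<omega>"
    and l: "0 < l"
  shows "((\<lambda>l. expectation (\<lambda>\<omega>. exp (- l * X \<omega>))) has_real_derivative
    - expectation (\<lambda>\<omega>. X \<omega> * exp (- l * X \<omega>))) (at l)"
proof -
  let ?F = "\<lambda>l. expectation (\<lambda>\<omega>. exp (- l * X \<omega>))"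
  have int: "integrable M (\<lambda>\<omega>. exp (- y * X \<omega>))" if "0 < y" for y
    using that nonneg by (intro integrable_const_bound[where B = 1]) auto
  have "((\<lambda>y. (?F y - ?F l) / (y - l)) \<longlongrightarrow> expectation (\<lambda>\<omega>. - (X \<omega> * exp (- l * X \<omega>))))
    (at l within {l / 2<..})"
    unfolding tendsto_at_iff_sequentially o_def
  proof (intro allI impI)
    fix Y :: "nat \<Rightarrow> real" assume "\<forall>n. Y n \<in> {l / 2<..} - {l}" and lim: "Y \<longlonglongrightarrow> l"
    then have Y: "l / 2 < Y n" "Y n \<noteq> l" for n by auto
    have "(\<lambda>n. expectation (\<lambda>\<omega>. (exp (- Y n * X \<omega>) - exp (- l * X \<omega>)) / (Y n - l)))
      \<longlonglongrightarrow> expectation (\<lambda>\<omega>. - (X \<omega> * exp (- l * X \<omega>)))"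
    proof (rule integral_dominated_convergence[where w = "\<lambda>_. 2 / l"])
      show "AE \<omega> in M. (\<lambda>n. (exp (- Y n * X \<omega>) - exp (- l * X \<omega>)) / (Y n - l))
          \<longlonglongrightarrow> - (X \<omega> * exp (- l * X \<omega>))"
      proof (rule AE_I2)
        fix \<omega>
        have "((\<lambda>y. exp (- y * X \<omega>)) has_real_derivative - (X \<omega> * exp (- l * X \<omega>))) (at l)"
          by (auto intro!: derivative_eq_intros)
        then have "((\<lambda>y. (exp (- y * X \<omega>) - exp (- l * X \<omega>)) / (y - l))
            \<longlongrightarrow> - (X \<omega> * exp (- l * X \<omega>))) (at l)"
          by (simp only: has_field_derivative_iff)
        then show "(\<lambda>n. (exp (- Y n * X \<omega>) - exp (- l * X \<omega>)) / (Y n - l))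
            \<longlonglongrightarrow> - (X \<omega> * exp (- l * X \<omega>))"
          unfolding tendsto_at_iff_sequentially o_def using lim Y(2) by blast
      qed
      show "AE \<omega> in M. norm ((exp (- Y n * X \<omega>) - exp (- l * X \<omega>)) / (Y n - l)) \<le> 2 / l" for n
      proof (rule AE_I2)
        fix \<omega> assume "\<omega> \<in> space M"
        have "\<bar>exp (- Y n * X \<omega>) - exp (- l * X \<omega>)\<bar> \<le> \<bar>Y n - l\<bar> * (X \<omega> * exp (- (l / 2) * X \<omega>))"
          using Y(1)[of n] l by (intro abs_diff_exp_le nonneg \<open>\<omega> \<in> space M\<close>) auto
        also have "\<dots> \<le> \<bar>Y n - l\<bar> * (2 / l)"
          using mult_exp_neg_le[of "l / 2" "X \<omega>"] l by (intro mult_left_mono) auto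
        finally show "norm ((exp (- Y n * X \<omega>) - exp (- l * X \<omega>)) / (Y n - l)) \<le> 2 / l"
          using Y(2)[of n] by (simp add: divide_le_eq mult.commute)
      qed
    qed auto
    moreover have "expectation (\<lambda>\<omega>. (exp (- Y n * X \<omega>) - exp (- l * X \<omega>)) / (Y n - l))
        = (?F (Y n) - ?F l) / (Y n - l)" for n
    proof -
      have "0 < Y n" using Y(1)[of n] l by linarith
      then show ?thesis
        by (simp only: integral_divide_zero Bochner_Integration.integral_diff[OF int int[OF l]])
    qed
    ultimately show "(\<lambda>n. (?F (Y n) - ?F l) / (Y n - l))
        \<longlonglongrightarrow> expectation (\<lambda>\<omega>. - (X \<omega> * exp (- l * X \<omega>)))"
      by (simp only:)
  qed
  moreover have "at l within {l / 2<..} = at l"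
    using l by (intro at_within_open) auto
  ultimately show ?thesis
    by (simp add: has_field_derivative_iff)
qed

section \<open>The cumulant flow and the Q-process\<close>

context CB_process
begin

lemma u_0: "0 < l \<Longrightarrow> u 0 l = l"
  and u_nonneg: "0 < l \<Longrightarrow> 0 \<le> t \<Longrightarrow> 0 \<le> u t l"
  and DERIV_u_within: "0 < l \<Longrightarrow> 0 \<le> t \<Longrightarrow>
    ((\<lambda>s. u s l) has_real_derivative - \<psi> (u t l)) (at t within {0..})"
  using cumulant_flow_u by (auto simp: cumulant_flow_def)

lemma DERIV_u_time:
  assumes "0 < l" "0 < t" shows "((\<lambda>s. u s l) has_real_derivative - \<psi> (u t l)) (at t)"
proof -
  have "at t within {0..} = at t" using assms(2) by (intro at_within_interior) (simp add: interior_real_atLeast)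
  then show ?thesis using DERIV_u_within[of l t] assms by simp
qed

lemma continuous_on_u_time:
  assumes "0 < l" shows "continuous_on {0..} (\<lambda>s. u s l)"
  using DERIV_u_within[OF assms] by (intro DERIV_continuous_on) auto

lemma u_le:
  assumes l: "0 < l" and t: "0 \<le> t" shows "u t l \<le> l"
proof -
  have "u t l \<le> u 0 l"
  proof (rule DERIV_nonpos_imp_decreasing_open[OF t])
    fix s assume "0 < s" "s < t"
    then show "\<exists>y. ((\<lambda>s. u s l) has_real_derivative y) (at s) \<and> y \<le> 0"
      using DERIV_u_time[OF l, of s] psi_nonneg[OF u_nonneg[OF l, of s]]
      by (intro exI[of _ "- \<psi> (u s l)"]) auto
  qed (rule continuous_on_subset[OF continuous_on_u_time[OF l]], auto)
  then show ?thesis by (simp add: u_0 l)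
qed

text \<open>Gronwall's argument: \<open>\<psi>(v) \<le> c v\<close> on \<open>[0, l]\<close>, where the flow stays, so \<open>u\<^sub>t exp(c t)\<close> is
nondecreasing.\<close>

lemma u_pos:
  assumes l: "0 < l" and t: "0 \<le> t" shows "0 < u t l"
proof -
  obtain c where c: "0 < c" "\<And>v. 0 \<le> v \<Longrightarrow> v \<le> l \<Longrightarrow> \<psi> v \<le> c * v"
    using psi_linear_bound[of l] by blast
  have "u 0 l * exp (c * 0) \<le> u t l * exp (c * t)"
  proof (rule DERIV_nonneg_imp_increasing_open[OF t])
    fix s assume "0 < s" "s < t"
    then have "((\<lambda>s. u s l * exp (c * s)) has_real_derivative (c * u s l - \<psi> (u s l)) * exp (c * s)) (at s)"
      by (auto intro!: derivative_eq_intros DERIV_u_time l simp: algebra_simps)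
    moreover have "0 \<le> (c * u s l - \<psi> (u s l)) * exp (c * s)"
      using c(2)[OF u_nonneg[OF l] u_le[OF l], of s] \<open>0 < s\<close> by simp
    ultimately show "\<exists>y. ((\<lambda>s. u s l * exp (c * s)) has_real_derivative y) (at s) \<and> 0 \<le> y" by blast
  qed (intro continuous_intros continuous_on_subset[OF continuous_on_u_time[OF l]], auto)
  then have "0 < u t l * exp (c * t)" using l by (simp add: u_0)
  then show ?thesis by (simp add: zero_less_mult_iff)
qed

text \<open>Along the flow \<open>\<phi>\<close> has derivative \<open>(- 1 / \<psi>(u)) (- \<psi>(u)) = 1\<close>: it measures time.\<close>

lemma phi_u:
  assumes l: "0 < l" and t: "0 \<le> t" shows "\<phi> (u t l) = \<phi> l + t"
proof (cases "t = 0")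
  case False
  then have t': "0 < t" using t by simp
  have "\<phi> (u t l) - t = \<phi> (u 0 l) - 0"
  proof (rule DERIV_isconst_end[OF t'])
    have "continuous_on {0..t} (\<lambda>s. \<phi> (u s l))"
      by (rule continuous_on_compose2[OF continuous_on_phi]) (auto intro: continuous_on_subset[OF continuous_on_u_time[OF l]] u_pos l)
    then show "continuous_on {0..t} (\<lambda>s. \<phi> (u s l) - s)" by (intro continuous_intros)
    fix s assume s: "0 < s" "s < t"
    have "((\<lambda>s. \<phi> (u s l)) has_real_derivative - (1 / \<psi> (u s l)) * - \<psi> (u s l)) (at s)"
      using s by (intro DERIV_chain2[OF DERIV_phi DERIV_u_time] u_pos l) auto
    moreover have "- (1 / \<psi> (u s l)) * - \<psi> (u s l) = 1"
      using psi_pos[OF u_pos[OF l, of s]] s by simp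
    ultimately have "((\<lambda>s. \<phi> (u s l)) has_real_derivative 1) (at s)" by simp
    from DERIV_diff[OF this DERIV_ident]
    show "((\<lambda>s. \<phi> (u s l) - s) has_real_derivative 0) (at s)" by simp
  qed
  then show ?thesis by (simp add: u_0 l)
qed (simp add: u_0 l)

lemma phi_inv_eq_u: "0 < l \<Longrightarrow> 0 \<le> t \<Longrightarrow> phi_inv \<alpha> \<sigma> \<pi> (\<phi> l + t) = u t l"
  using phi_inv_phi[OF u_pos] by (simp add: phi_u)

text \<open>By \<open>phi_u\<close>, \<open>u\<^sub>t\<close> is the composition of the inverse of \<open>\<phi>\<close> with \<open>l \<mapsto> \<phi>(l) + t\<close>.\<close>

lemma DERIV_u_initial:
  assumes l: "0 < l" and t: "0 \<le> t"
  shows "((\<lambda>l. u t l) has_real_derivative \<psi> (u t l) / \<psi> l) (at l)"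
proof -
  let ?g = "phi_inv \<alpha> \<sigma> \<pi>" and ?a = "u t l"
  have a: "0 < ?a" by (rule u_pos[OF l t])
  have "(?g has_derivative (*) (- \<psi> ?a)) (at (\<phi> ?a))"
  proof (rule has_derivative_inverse_strong[where S = "{0<..}" and f = \<phi> and x = ?a and f' = "(*) (- (1 / \<psi> ?a))"])
    show "(\<phi> has_derivative (*) (- (1 / \<psi> ?a))) (at ?a)"
      using DERIV_phi[OF a] by (simp only: has_field_derivative_def)
    show "(*) (- (1 / \<psi> ?a)) \<circ> (*) (- \<psi> ?a) = id"
      using psi_pos[OF a] by (auto simp: fun_eq_iff)
  qed (use a in \<open>auto simp: continuous_on_phi phi_inv_phi\<close>)
  then have g: "(?g has_real_derivative - \<psi> ?a) (at (\<phi> l + t))"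
    by (simp only: has_field_derivative_def phi_u[OF l t])
  have "((\<lambda>l. \<phi> l + t) has_real_derivative - (1 / \<psi> l)) (at l)"
    using DERIV_add[OF DERIV_phi[OF l] DERIV_const[of t]] by simp
  from DERIV_chain2[OF g this]
  have "((\<lambda>l. ?g (\<phi> l + t)) has_real_derivative \<psi> ?a / \<psi> l) (at l)" by simp
  then show ?thesis
    by (rule has_field_derivative_transform_within_open[of _ _ _ "{0<..}"]) (auto simp: phi_inv_eq_u l t)
qed

lemma u_tendsto_0:
  assumes l: "0 < l" shows "filterlim (\<lambda>t. u t l) (at_right 0) at_top"
  unfolding filterlim_at
proof
  show "\<forall>\<^sub>F t in at_top. u t l \<in> {0<..} \<and> u t l \<noteq> 0"
    using eventually_ge_at_top[of "0::real"] by eventually_elim (use u_pos[OF l] in force)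
  show "((\<lambda>t. u t l) \<longlongrightarrow> 0) at_top"
  proof (rule tendstoI)
    fix e :: real assume e: "0 < e"
    have "\<forall>\<^sub>F t in at_top. 0 \<le> t \<and> \<phi> e - \<phi> l < t"
      by (intro eventually_conj eventually_ge_at_top eventually_gt_at_top)
    then show "\<forall>\<^sub>F t in at_top. dist (u t l) 0 < e"
    proof eventually_elim
      case (elim t)
      then have "\<phi> e < \<phi> (u t l)" by (simp add: phi_u[OF l])
      then have "u t l < e"
        using phi_strict_antimono[OF e, of "u t l"] by (cases "u t l" e rule: linorder_cases) auto
      then show ?case using u_pos[OF l, of t] elim by simp
    qed
  qed
qed

text \<open>Both sides are minus the derivative in \<open>l\<close> of the Laplace transform of \<open>Z\<^sub>t\<close>.\<close>

lemma expectation_Z_exp: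
  assumes x: "0 < x" and t: "0 \<le> t" and l: "0 < l"
  shows "(\<integral>\<omega>. Z t \<omega> * exp (- l * Z t \<omega>) \<partial>P x) = x * (\<psi> (u t l) / \<psi> l) * exp (- x * u t l)"
proof -
  have x0: "0 \<le> x" using x by simp
  interpret prob_space "P x" by (rule prob_space_P[OF x0])
  have meas: "Z t \<in> borel_measurable (P x)"
    using measurable_Z[OF t] by (simp add: measurable_cong_sets[OF sets_P[OF x0] refl])
  have space: "space (P x) = space M" by (rule sets_eq_imp_space_eq[OF sets_P[OF x0]])
  have "((\<lambda>l. \<integral>\<omega>. exp (- l * Z t \<omega>) \<partial>P x) has_real_derivative
      - (\<integral>\<omega>. Z t \<omega> * exp (- l * Z t \<omega>) \<partial>P x)) (at l)"
    by (rule DERIV_expectation_exp[OF meas _ l]) (simp add: space nonneg_Z[OF t])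
  then have "((\<lambda>l. exp (- x * u t l)) has_real_derivative
      - (\<integral>\<omega>. Z t \<omega> * exp (- l * Z t \<omega>) \<partial>P x)) (at l)"
    by (rule has_field_derivative_transform_within_open[of _ _ _ "{0<..}"])
      (simp, use l in simp, simp only: laplace_Z[OF x0 t] greaterThan_iff)
  moreover have "((\<lambda>l. exp (- x * u t l)) has_real_derivative
      exp (- x * u t l) * (- x * (\<psi> (u t l) / \<psi> l))) (at l)"
    by (intro DERIV_chain2[OF DERIV_exp] DERIV_cmult DERIV_u_initial l t)
  ultimately have "- (\<integral>\<omega>. Z t \<omega> * exp (- l * Z t \<omega>) \<partial>P x)
      = exp (- x * u t l) * (- x * (\<psi> (u t l) / \<psi> l))"
    by (rule DERIV_unique)
  then show ?thesis by simp
qed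

lemma measurable_Z_natural_filtration:
  assumes "0 \<le> s" "s \<le> t"
  shows "Z s \<in> borel_measurable (natural_filtration M Z (ennreal t))"
proof (rule measurableI)
  fix A :: "real set" assume A: "A \<in> sets borel"
  have "space (natural_filtration M Z (ennreal t)) = space M"
    unfolding natural_filtration_def by (rule space_measure_of_conv)
  moreover have "Z s -` A \<inter> space M \<in> sets (natural_filtration M Z (ennreal t))"
    unfolding natural_filtration_def
    by (rule in_measure_of) (use A assms in \<open>auto simp: ennreal_leI\<close>)
  ultimately show "Z s -` A \<inter> space (natural_filtration M Z (ennreal t))
      \<in> sets (natural_filtration M Z (ennreal t))" by simp
qed simp

lemma subalgebra_natural_filtration:
  assumes "sets N = sets M" shows "subalgebra N (natural_filtration M Z (ennreal t))"
proof -
  have "sets (natural_filtration M Z (ennreal t)) \<subseteq> sets M"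
    unfolding natural_filtration_def
    by (subst sets_measure_of) (auto intro!: sets.sigma_sets_subset measurable_sets[OF measurable_Z])
  moreover have "space (natural_filtration M Z (ennreal t)) = space M"
    unfolding natural_filtration_def by (rule space_measure_of_conv)
  ultimately show ?thesis
    using assms sets_eq_imp_space_eq[OF assms] by (simp add: subalgebra_def)
qed

text \<open>The density \<open>M\<^sub>t / M\<^sub>0\<close> is only prescribed on the \<open>\<sigma>\<close>-algebra at time \<open>t\<close>, which is enough
because \<open>Z\<^sub>t\<close> is measurable with respect to it.\<close>

lemma Q_expectation_eq:
  fixes f :: "real \<Rightarrow> real"
  assumes x: "0 < x" and Q: "is_Q_measure \<alpha> M Z (P x) Q" and t: "0 \<le> t"
    and f [measurable]: "f \<in> borel_measurable borel"
  shows "(\<integral>\<omega>. f (Z t \<omega>) \<partial>Q) = exp (\<alpha> * t) / x * (\<integral>\<omega>. Z t \<omega> * f (Z t \<omega>) \<partial>P x)"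
proof -
  have x0: "0 \<le> x" using x by simp
  let ?F = "natural_filtration M Z (ennreal t)"
  let ?D = "\<lambda>\<omega>. Q_martingale \<alpha> Z t \<omega> / Q_martingale \<alpha> Z 0 \<omega>"
  have Q': "sets Q = sets M"
      "restr_to_subalg Q ?F = density (restr_to_subalg (P x) ?F) (\<lambda>\<omega>. ennreal (?D \<omega>))"
    using Q t by (auto simp: is_Q_measure_def)
  note subQ = subalgebra_natural_filtration[OF Q'(1), of t]
  note subP = subalgebra_natural_filtration[OF sets_P[OF x0], of t]
  have [measurable]: "Z t \<in> borel_measurable ?F" "Z 0 \<in> borel_measurable ?F"
    using t by (auto intro: measurable_Z_natural_filtration)
  have fF: "(\<lambda>\<omega>. f (Z t \<omega>)) \<in> borel_measurable ?F" by measurable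
  have DF: "?D \<in> borel_measurable ?F" unfolding Q_martingale_def by measurable
  have space: "space (P x) = space M" by (rule sets_eq_imp_space_eq[OF sets_P[OF x0]])
  have "(\<integral>\<omega>. f (Z t \<omega>) \<partial>Q) = (\<integral>\<omega>. f (Z t \<omega>) \<partial>restr_to_subalg Q ?F)"
    by (rule integral_subalgebra2[OF subQ fF, symmetric])
  also have "\<dots> = (\<integral>\<omega>. ?D \<omega> * f (Z t \<omega>) \<partial>restr_to_subalg (P x) ?F)"
    unfolding Q'(2)
  proof (rule integral_real_density)
    show "?D \<in> borel_measurable (restr_to_subalg (P x) ?F)"
      by (rule measurable_in_subalg[OF subP DF])
    show "(\<lambda>\<omega>. f (Z t \<omega>)) \<in> borel_measurable (restr_to_subalg (P x) ?F)"
      by (rule measurable_in_subalg[OF subP fF])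
    show "AE \<omega> in restr_to_subalg (P x) ?F. 0 \<le> ?D \<omega>"
      by (rule AE_I2) (simp add: space_restr_to_subalg space Q_martingale_def nonneg_Z t)
  qed
  also have "\<dots> = (\<integral>\<omega>. ?D \<omega> * f (Z t \<omega>) \<partial>P x)"
    by (rule integral_subalgebra2[OF subP borel_measurable_times[OF DF fF]])
  also have "\<dots> = (\<integral>\<omega>. exp (\<alpha> * t) / x * (Z t \<omega> * f (Z t \<omega>)) \<partial>P x)"
  proof (rule integral_cong_AE)
    have [measurable]: "Z t \<in> borel_measurable (P x)"
      using measurable_Z[OF t] by (simp add: measurable_cong_sets[OF sets_P[OF x0] refl])
    show "(\<lambda>\<omega>. exp (\<alpha> * t) / x * (Z t \<omega> * f (Z t \<omega>))) \<in> borel_measurable (P x)" by measurable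
    show "(\<lambda>\<omega>. ?D \<omega> * f (Z t \<omega>)) \<in> borel_measurable (P x)"
      by (rule measurable_from_subalg[OF subP borel_measurable_times[OF DF fF]])
    show "AE \<omega> in P x. ?D \<omega> * f (Z t \<omega>) = exp (\<alpha> * t) / x * (Z t \<omega> * f (Z t \<omega>))"
      using start_Z[OF x0] by eventually_elim (simp add: Q_martingale_def)
  qed
  finally show ?thesis by simp
qed

lemma
  assumes Q: "is_Q_measure \<alpha> M Z (P x) Q" and t: "0 \<le> t"
  shows measurable_Z_Q: "Z t \<in> borel_measurable Q"
    and real_distribution_Z_Q: "real_distribution (distr Q borel (Z t))"
    and AE_distr_Z_Q_nonneg: "AE v in distr Q borel (Z t). 0 \<le> v"
proof -
  interpret prob_space Q using Q by (simp add: is_Q_measure_def)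
  have sets: "sets Q = sets M" using Q by (simp add: is_Q_measure_def)
  show meas: "Z t \<in> borel_measurable Q"
    using measurable_Z[OF t] by (simp add: measurable_cong_sets[OF sets refl])
  then show "real_distribution (distr Q borel (Z t))" by (rule real_distribution_distr)
  show "AE v in distr Q borel (Z t). 0 \<le> v"
    using nonneg_Z[OF t] by (subst AE_distr_iff[OF meas]) (auto simp: sets_eq_imp_space_eq[OF sets])
qed

text \<open>The factor \<open>exp(\<alpha> t)\<close> is absorbed through \<open>\<alpha> t = \<alpha> \<phi>(u\<^sub>t(l)) - \<alpha> \<phi>(l)\<close>.\<close>

lemma laplace_Z_Q:
  assumes x: "0 < x" and Q: "is_Q_measure \<alpha> M Z (P x) Q" and t: "0 \<le> t" and l: "0 < l"
  shows "laplace (distr Q borel (Z t)) l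
    = tilted_psi (u t l) / tilted_psi l * exp (- x * u t l)"
proof -
  have "laplace (distr Q borel (Z t)) l = (\<integral>\<omega>. exp (- l * Z t \<omega>) \<partial>Q)"
    unfolding laplace_def by (rule integral_distr[OF measurable_Z_Q[OF Q t]]) measurable
  also have "\<dots> = exp (\<alpha> * t) / x * (\<integral>\<omega>. Z t \<omega> * exp (- l * Z t \<omega>) \<partial>P x)"
    by (rule Q_expectation_eq[OF x Q t]) measurable
  also have "\<dots> = exp (\<alpha> * t) * (\<psi> (u t l) / \<psi> l) * exp (- x * u t l)"
    unfolding expectation_Z_exp[OF x t l] using x by simp
  also have "exp (\<alpha> * t) * (\<psi> (u t l) / \<psi> l) = tilted_psi (u t l) / tilted_psi l"
    by (simp add: tilted_psi_def phi_u[OF l t] distrib_left exp_add)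
  finally show ?thesis .
qed

lemma laplace_Z_Q_tendsto:
  assumes x: "0 < x" and Q: "is_Q_measure \<alpha> M Z (P x) Q" and l: "0 < l"
    and h: "(tilted_psi \<longlongrightarrow> h) (at_right 0)"
  shows "((\<lambda>t. laplace (distr Q borel (Z t)) l) \<longlongrightarrow> h / tilted_psi l) at_top"
proof -
  have u0: "((\<lambda>t. u t l) \<longlongrightarrow> 0) at_top"
    using u_tendsto_0[OF l] by (simp add: filterlim_at)
  have "((\<lambda>t. tilted_psi (u t l) / tilted_psi l * exp (- x * u t l)) \<longlongrightarrow>
      h / tilted_psi l * exp (- x * 0)) at_top"
    using tilted_psi_pos[OF l]
    by (intro tendsto_intros u0 filterlim_compose[OF h u_tendsto_0[OF l]]) auto
  moreover have "\<forall>\<^sub>F t in at_top. tilted_psi (u t l) / tilted_psi l * exp (- x * u t l)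
      = laplace (distr Q borel (Z t)) l"
    using eventually_ge_at_top[of "0::real"]
    by eventually_elim (simp only: laplace_Z_Q[OF x Q _ l])
  ultimately show ?thesis by (auto intro: Lim_transform_eventually)
qed

text \<open>For \<open>q > \<phi>(1)\<close> the inverse of \<open>\<phi>\<close> at \<open>q\<close> is \<open>u\<close> at time \<open>q - \<phi>(1)\<close> started from \<open>1\<close>. Using the flow in
this way shows that \<open>q\<close> is in the range of \<open>\<phi>\<close> and that the inverse tends to \<open>0\<close>.\<close>

lemma laplace_V_tendsto:
  assumes V: "\<And>q. 0 < q \<Longrightarrow> is_V_law \<alpha> \<sigma> \<pi> q (V q)" and l: "0 < l"
    and h: "(tilted_psi \<longlongrightarrow> h) (at_right 0)"
  shows "((\<lambda>q. laplace (V q) l) \<longlongrightarrow> h / tilted_psi l) at_top"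
proof -
  let ?a = "\<lambda>q. u (q - \<phi> 1) 1"
  have "filterlim (\<lambda>q. q - \<phi> 1) at_top (at_top :: real filter)"
    using filterlim_tendsto_add_at_top[OF tendsto_const filterlim_ident, of "- \<phi> 1"] by simp
  then have a: "filterlim ?a (at_right 0) at_top"
    by (rule filterlim_compose[OF u_tendsto_0[OF zero_less_one]])
  then have a0: "(?a \<longlongrightarrow> 0) at_top" by (simp add: filterlim_at)
  have "((\<lambda>q. tilted_psi (?a q) / tilted_psi (l + ?a q)) \<longlongrightarrow> h / tilted_psi (l + 0)) at_top"
    using tilted_psi_pos[OF l] l
    by (intro tendsto_intros filterlim_compose[OF h a]
        isCont_tendsto_compose[OF isCont_tilted_psi] a0) auto
  moreover have "\<forall>\<^sub>F q in at_top. tilted_psi (?a q) / tilted_psi (l + ?a q) = laplace (V q) l"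
    using eventually_gt_at_top[of "\<phi> 1"]
  proof eventually_elim
    case (elim q)
    then have q: "0 \<le> q - \<phi> 1" "0 < q" using phi_nonneg[of 1] by auto
    have phi_a: "\<phi> (?a q) = q" using phi_u[OF zero_less_one q(1)] by simp
    have inv: "phi_inv \<alpha> \<sigma> \<pi> q = ?a q" using phi_inv_eq_u[OF zero_less_one q(1)] by simp
    have "laplace (V q) l = exp (- \<alpha> * (\<phi> (l + ?a q) - q)) * (\<psi> (?a q) / \<psi> (l + ?a q))"
      unfolding laplace_def using V[OF q(2)] l by (simp add: is_V_law_def inv)
    also have "\<dots> = tilted_psi (?a q) / tilted_psi (l + ?a q)"
      unfolding tilted_psi_def phi_a by (simp add: right_diff_distrib exp_diff mult_ac)
    finally show ?case by simp
  qed
  ultimately show ?thesis by (auto intro: Lim_transform_eventually)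
qed

text \<open>The continuity theorem along integer times produces a law with transform \<open>h / H\<close>; since a law on the
half-line is determined by its transform, both families converge to it along all times.\<close>

theorem Q_process_limit_law:
  assumes x: "0 < x" and Q: "is_Q_measure \<alpha> M Z (P x) Q"
    and V: "\<And>q. 0 < q \<Longrightarrow> is_V_law \<alpha> \<sigma> \<pi> q (V q)"
    and lm: "log_moment_condition \<alpha> \<pi>"
  obtains \<nu> where "positive_law \<nu>" "weak_conv_along (\<lambda>t. distr Q borel (Z t)) \<nu> at_top"
    "is_V_infinity_law V \<nu>"
proof -
  obtain h where h: "(tilted_psi \<longlongrightarrow> h) (at_right 0)" "0 < h"
    using tilted_psi_tendsto_at_right_0 lm by metis
  let ?L = "\<lambda>l. h / tilted_psi l"
  have L1: "(?L \<longlongrightarrow> 1) (at_right 0)"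
    using tendsto_divide[OF tendsto_const h(1), of h] h(2) by simp
  obtain \<nu> where \<nu>: "real_distribution \<nu>" "AE v in \<nu>. 0 \<le> v" "\<And>l. 0 < l \<Longrightarrow> laplace \<nu> l = ?L l"
  proof (rule Laplace_limit_is_Laplace_transform[OF _ _ _ L1])
    show "real_distribution (distr Q borel (Z (real n)))" for n
      by (rule real_distribution_Z_Q[OF Q]) simp
    show "AE v in distr Q borel (Z (real n)). 0 \<le> v" for n
      by (rule AE_distr_Z_Q_nonneg[OF Q]) simp
    show "(\<lambda>n. laplace (distr Q borel (Z (real n))) l) \<longlonglongrightarrow> ?L l" if "0 < l" for l
      by (rule filterlim_compose[OF laplace_Z_Q_tendsto[OF x Q that h(1)] filterlim_real_sequentially])
  qed (rule that)
  interpret \<nu>: real_distribution \<nu> by (rule \<nu>(1))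
  \<comment> \<open>An atom at \<open>0\<close> would survive in the transform at \<open>l = \<infinity>\<close>.\<close>
  have atom: "measure \<nu> {0} \<le> laplace \<nu> l" if "0 < l" for l
  proof -
    have ind: "integrable \<nu> (indicator {0} :: real \<Rightarrow> real)"
      by (rule integrable_real_indicator) (auto simp: \<nu>.emeasure_eq_measure)
    have "measure \<nu> {0} = (\<integral>v. indicator {0} v \<partial>\<nu>)" by simp
    also have "\<dots> \<le> laplace \<nu> l"
      unfolding laplace_def
      by (intro integral_mono ind integrable_exp_neg_mult[OF \<nu>(1,2)])
        (use that in \<open>auto simp: indicator_def\<close>)
    finally show ?thesis .
  qed
  have "(?L \<longlongrightarrow> 0) at_top"
  proof (rule real_tendsto_divide_at_top[OF tendsto_const])
    show "filterlim tilted_psi at_top at_top"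
      by (rule filterlim_at_top_mono[OF psi_at_top eventually_mono[OF eventually_gt_at_top[of 0]]])
        (rule psi_le_tilted_psi)
  qed
  moreover have "\<forall>\<^sub>F l in at_top. measure \<nu> {0} \<le> ?L l"
    using eventually_gt_at_top[of "0::real"] by eventually_elim (use atom \<nu>(3) in simp)
  ultimately have "measure \<nu> {0} \<le> 0" by (rule tendsto_lowerbound) simp
  then have "measure \<nu> {0} = 0" by (simp add: measure_le_0_iff)
  then have "AE v in \<nu>. v \<notin> {0}" by (subst (asm) \<nu>.prob_eq_0) auto
  with \<nu>(2) have "AE v in \<nu>. v \<in> {0<..}" by eventually_elim auto
  then have "measure \<nu> {0<..} = 1" by (subst \<nu>.prob_eq_1) auto
  then have pos: "positive_law \<nu>" using \<nu>(1) by (simp add: positive_law_def)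
  have "weak_conv_along (\<lambda>t. distr Q borel (Z t)) \<nu> at_top"
    by (rule weak_conv_along_at_top_of_laplace[of 0])
      (use real_distribution_Z_Q[OF Q] AE_distr_Z_Q_nonneg[OF Q] \<nu> laplace_Z_Q_tendsto[OF x Q _ h(1)] in auto)
  moreover have "weak_conv_along V \<nu> at_top"
  proof (rule weak_conv_along_at_top_of_laplace[of 1])
    fix q :: real assume "1 \<le> q"
    then have "positive_law (V q)" using V[of q] by (simp add: is_V_law_def)
    then show rd: "real_distribution (V q)" and "AE v in V q. 0 \<le> v"
    proof -
      show "real_distribution (V q)" using \<open>positive_law (V q)\<close> by (simp add: positive_law_def)
      then interpret real_distribution "V q" .
      have "AE v in V q. v \<in> {0<..}"
        using \<open>positive_law (V q)\<close> by (subst prob_eq_1[symmetric]) (auto simp: positive_law_def)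
      then show "AE v in V q. 0 \<le> v" by eventually_elim simp
    qed
  qed (use \<nu> laplace_V_tendsto[OF V _ h(1)] in auto)
  ultimately show thesis using pos that by (simp add: is_V_infinity_law_def)
qed

text \<open>Markov's inequality gives \<open>Q(Z\<^sub>t \<le> K) \<le> exp(K) E[exp(- Z\<^sub>t)]\<close>, and the right-hand side tends to
\<open>0\<close> because \<open>H(0+) = 0\<close>.\<close>

theorem Q_process_tendsto_infinity:
  assumes x: "0 < x" and Q: "is_Q_measure \<alpha> M Z (P x) Q"
    and lm: "\<not> log_moment_condition \<alpha> \<pi>"
  shows "((\<lambda>t. measure Q {\<omega> \<in> space Q. Z t \<omega> > K}) \<longlongrightarrow> 1) at_top"
proof -
  interpret Q: prob_space Q using Q by (simp add: is_Q_measure_def)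
  obtain h where h: "(tilted_psi \<longlongrightarrow> h) (at_right 0)" "h = 0"
    using tilted_psi_tendsto_at_right_0 lm by (metis less_eq_real_def)
  have lim: "((\<lambda>t. laplace (distr Q borel (Z t)) 1) \<longlongrightarrow> 0) at_top"
    using laplace_Z_Q_tendsto[OF x Q zero_less_one h(1)] h(2) by simp
  have "((\<lambda>t. 1 - exp K * laplace (distr Q borel (Z t)) 1) \<longlongrightarrow> 1 - exp K * 0) at_top"
    by (intro tendsto_intros lim)
  then have lower: "((\<lambda>t. 1 - exp K * laplace (distr Q borel (Z t)) 1) \<longlongrightarrow> 1) at_top" by simp
  have "\<forall>\<^sub>F t in at_top. 1 - exp K * laplace (distr Q borel (Z t)) 1
      \<le> measure Q {\<omega> \<in> space Q. Z t \<omega> > K}"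
    using eventually_ge_at_top[of "0::real"]
  proof eventually_elim
    case (elim t)
    let ?\<mu> = "distr Q borel (Z t)"
    interpret \<mu>: real_distribution ?\<mu> by (rule real_distribution_Z_Q[OF Q elim])
    note int = integrable_exp_neg_mult[OF \<mu>.real_distribution_axioms AE_distr_Z_Q_nonneg[OF Q elim], of 1]
    have ind: "integrable ?\<mu> (indicator {..K} :: real \<Rightarrow> real)"
      by (rule integrable_real_indicator) (auto simp: \<mu>.emeasure_eq_measure)
    have "measure ?\<mu> {..K} = (\<integral>v. indicator {..K} v \<partial>?\<mu>)" by simp
    also have "\<dots> \<le> (\<integral>v. exp K * exp (- 1 * v) \<partial>?\<mu>)"
      by (intro integral_mono ind integrable_mult_right int) (auto simp: indicator_def mult_exp_exp)
    also have "\<dots> = exp K * laplace ?\<mu> 1" unfolding laplace_def by (rule integral_mult_right_zero)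
    finally have "measure ?\<mu> {..K} \<le> exp K * laplace ?\<mu> 1" .
    moreover have "measure ?\<mu> {K<..} = 1 - measure ?\<mu> {..K}"
      using \<mu>.prob_compl[of "{..K}"] by (simp add: Compl_eq_Diff_UNIV[symmetric] Compl_atMost)
    moreover have "measure ?\<mu> {K<..} = measure Q {\<omega> \<in> space Q. Z t \<omega> > K}"
      by (subst measure_distr[OF measurable_Z_Q[OF Q elim]]) (auto intro!: arg_cong[where f = "measure Q"])
    ultimately show ?case by linarith
  qed
  moreover have "\<forall>\<^sub>F t in at_top. measure Q {\<omega> \<in> space Q. Z t \<omega> > K} \<le> 1"
    by (intro always_eventually allI Q.prob_le_1)
  ultimately show ?thesis by (rule tendsto_sandwich[OF _ _ lower tendsto_const])
qed

end

theorem proposition4p9: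
  fixes \<alpha> \<sigma> x :: real and \<pi> :: "real measure"
    and M :: "'w measure" and Z :: "real \<Rightarrow> 'w \<Rightarrow> real"
    and P :: "real \<Rightarrow> 'w measure" and u :: "real \<Rightarrow> real \<Rightarrow> real"
    and Q :: "'w measure" and V :: "real \<Rightarrow> real measure"
  assumes CB: "CB_process \<alpha> \<sigma> \<pi> M Z P u"
    and x: "0 < x"
    and Q: "is_Q_measure \<alpha> M Z (P x) Q"
    and V: "\<And>q. 0 < q \<Longrightarrow> is_V_law \<alpha> \<sigma> \<pi> q (V q)"
  shows "(log_moment_condition \<alpha> \<pi> \<longrightarrow>
            (\<exists>Z_inf. positive_law Z_inf \<and>
               weak_conv_along (\<lambda>t. distr Q borel (Z t)) Z_inf at_top \<and>
               is_V_infinity_law V Z_inf)) \<and>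
         (\<not> log_moment_condition \<alpha> \<pi> \<longrightarrow>
            (\<forall>K>0. ((\<lambda>t. measure Q {\<omega> \<in> space Q. Z t \<omega> > K}) \<longlongrightarrow> 1) at_top))"
proof -
  interpret CB_process \<alpha> \<sigma> \<pi> M Z P u by (rule CB)
  show ?thesis
    using Q_process_limit_law[OF x Q V] Q_process_tendsto_infinity[OF x Q] by metis
qed

end
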